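(* For every graphon $W$, the limit $\lim_{k\to\infty}\big(\mathbb P(X_k(W)=0)\big)^{1/k}$ exists and $$\alpha(W)=\lim_{k\to\infty}\big(\mathbb P(X_k(W)=0)\big)^{1/k}.$$
   Context: A graphon is a measurable symmetric function $W:[0,1]^2\to[0,1]$ (Lebesgue measure on $[0,1]$). For an integer $k\ge 1$, the $k$-sample $\mathbb G(k,W)$ is the random graph on $\{1,\dots,k\}$ obtained by sampling $x_1,\dots,x_k\in[0,1]$ uniformly at random and making each pair $\{i,j\}\subseteq\{1,\dots,k\}$ with $i\ne j$ an edge with probability $W(x_i,x_j)$, all these choices being mutually independent. $X_k(W)$ denotes the number of edges of $\mathbb G(k,W)$. The independence ratio $\alpha(W)$ is the supremum of the Lebesgue measure of measurable $S\subseteq[0,1]$ such that $W(x,y)=0$ for a.e. $(x,y)\in S^2$. *)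

theory Defs
  imports "HOL-Probability.Probability"
begin

text \<open>
  Functions on the unit square are total functions of type \<open>real \<Rightarrow> real \<Rightarrow> real\<close>; their values
  outside the unit square are irrelevant. ``Measurable'' means Lebesgue measurable.
\<close>

definition graphon :: "(real \<Rightarrow> real \<Rightarrow> real) \<Rightarrow> bool" where
  "graphon W \<longleftrightarrow>
     (\<lambda>(x, y). W x y) \<in> borel_measurable (lebesgue_on ({0..1} \<times> {0..1})) \<and>
     (\<forall>x\<in>{0..1}. \<forall>y\<in>{0..1}. W x y = W y x) \<and>
     (\<forall>x\<in>{0..1}. \<forall>y\<in>{0..1}. 0 \<le> W x y \<and> W x y \<le> 1)"

definition independent_in :: "(real \<Rightarrow> real \<Rightarrow> real) \<Rightarrow> real set \<Rightarrow> bool" where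
  "independent_in W S \<longleftrightarrow>
     S \<in> sets lebesgue \<and> S \<subseteq> {0..1} \<and> (AE (x, y) in lebesgue_on (S \<times> S). W x y = 0)"

text \<open>The supremum is taken over a set containing \<open>0\<close> (from \<open>S = {}\<close>) and bounded by \<open>1\<close>.\<close>

definition independence_ratio :: "(real \<Rightarrow> real \<Rightarrow> real) \<Rightarrow> real" where
  "independence_ratio W = (SUP S\<in>{S. independent_in W S}. measure lebesgue S)"

definition vertex_pairs :: "nat \<Rightarrow> nat set set" where
  "vertex_pairs k = {e. e \<subseteq> {1..k} \<and> card e = 2}"

text \<open>
  The law of \<open>k\<close> independent uniform points of the unit interval. The completion makes
  \<open>W (x i) (x j)\<close> measurable in \<open>x\<close> also when \<open>W\<close> is Lebesgue but not Borel measurable.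
\<close>

definition sample_points :: "nat \<Rightarrow> (nat \<Rightarrow> real) measure" where
  "sample_points k = completion (\<Pi>\<^sub>M i\<in>{1..k}. lebesgue_on {0..1})"

text \<open>
  A graph with vertex set \<open>{1..k}\<close> is represented by its set of edges. For given points \<open>x\<close>, the
  pairs are independent, and \<open>e = {i, j}\<close> is an edge with probability \<open>W (x i) (x j)\<close>; as \<open>W\<close> is
  symmetric, the choice of \<open>i = Min e\<close> and \<open>j = Max e\<close> is immaterial.
\<close>

definition edges_given :: "nat \<Rightarrow> (real \<Rightarrow> real \<Rightarrow> real) \<Rightarrow> (nat \<Rightarrow> real) \<Rightarrow> nat set set pmf" where
  "edges_given k W x =
     map_pmf (\<lambda>b. {e \<in> vertex_pairs k. b e})
       (Pi_pmf (vertex_pairs k) False (\<lambda>e. bernoulli_pmf (W (x (Min e)) (x (Max e)))))"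

definition sample_graph :: "nat \<Rightarrow> (real \<Rightarrow> real \<Rightarrow> real) \<Rightarrow> nat set set measure" where
  "sample_graph k W = sample_points k \<bind> (\<lambda>x. measure_pmf (edges_given k W x))"

text \<open>Samples are almost surely subsets of the finite set \<open>vertex_pairs k\<close>, so \<open>card\<close> is meaningful.\<close>

definition edge_count :: "nat set set \<Rightarrow> nat" where
  "edge_count E = card E"

end

theory Submission
  imports Defs "HOL-Real_Asymp.Real_Asymp"
begin

text \<open>
  Write \<open>p k\<close> for the probability of having no edges; it is the integral of
  \<open>\<Prod>i<j. 1 - W (x i) (x j)\<close>. If \<open>S\<close> is independent, then \<open>p k \<ge> |S| ^ k\<close>.

  For the upper bound, weight the points by a function \<open>h\<close> with values in \<open>[0, 1]\<close>, and let \<open>D\<close> be the set of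
  points \<open>x\<close> of degree \<open>\<integral> h(y) W(x, y) dy \<ge> d\<close>. Either all points avoid \<open>D\<close>, which confines them
  to a container \<open>g = h 1_{-D}\<close> with \<open>\<integral>\<integral> g(x) g(y) W(x, y) \<le> d\<close>, or one of the \<open>k\<close> points lies in \<open>D\<close>, and
  conditioning on it lowers the total weight by at least \<open>d\<close>. The second case occurs at most \<open>1/d\<close> times, so
  \<open>p k\<close> is at most a polynomial in \<open>k\<close> times \<open>b ^ k\<close>, where \<open>b\<close> bounds the integrals of the containers.

  As \<open>d\<close> tends to \<open>0\<close>, the bound \<open>b\<close> can be taken arbitrarily close to the independence ratio: functions \<open>g n\<close>
  with vanishing energy and integrals at least \<open>b\<close> yield an independent set of measure at least
  \<open>b\<close>, because the integral operator with kernel \<open>W\<close> is compact.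
\<close>

section \<open>The container bound\<close>

text \<open>This extends \<open>vertex_pairs\<close> to arbitrary index sets, because the induction
  deletes single vertices from \<open>{1..k}\<close>.\<close>

definition pairs :: "nat set \<Rightarrow> nat set set" where
  "pairs I = {e. e \<subseteq> I \<and> card e = 2}"

lemma finite_pairs: "finite I \<Longrightarrow> finite (pairs I)"
  by (simp add: pairs_def)

lemma pairsE:
  assumes "e \<in> pairs I"
  obtains i j where "e = {i, j}" "i < j" "i \<in> I" "j \<in> I" "Min e = i" "Max e = j"
proof -
  obtain a b where e: "e = {a, b}" "a \<noteq> b" "a \<in> I" "b \<in> I"
    using assms by (auto simp: pairs_def card_2_iff)
  then have "e = {min a b, max a b}" "min a b < max a b" "min a b \<in> I" "max a b \<in> I"
    by (auto simp: min_def max_def)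
  then show thesis
    using that by (metis Max_singleton Max_insert Min_insert Min_singleton finite.intros
        insert_not_empty max_absorb2 min_absorb1 less_imp_le)
qed

lemma pairs_insert:
  assumes "i \<notin> I"
  shows "pairs (insert i I) = pairs I \<union> (\<lambda>j. {i, j}) ` I"
proof (intro set_eqI iffI)
  fix e assume e: "e \<in> pairs (insert i I)"
  then obtain a b where ab: "e = {a, b}" "a \<noteq> b" "a \<in> insert i I" "b \<in> insert i I"
    by (auto simp: pairs_def card_2_iff)
  then show "e \<in> pairs I \<union> (\<lambda>j. {i, j}) ` I"
    using e by (auto simp: pairs_def)
qed (use assms in \<open>auto simp: pairs_def card_2_iff\<close>)

lemma prod_pairs_insert:
  fixes F :: "nat set \<Rightarrow> 'b::comm_monoid_mult"
  assumes "finite I" "i \<notin> I"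
  shows "(\<Prod>e\<in>pairs (insert i I). F e) = (\<Prod>e\<in>pairs I. F e) * (\<Prod>j\<in>I. F {i, j})"
proof -
  have inj: "inj_on (\<lambda>j. {i, j}) I"
    using assms by (auto simp: inj_on_def doubleton_eq_iff)
  have "pairs I \<inter> (\<lambda>j. {i, j}) ` I = {}"
    using assms by (auto simp: pairs_def)
  then show ?thesis
    using assms by (simp add: pairs_insert prod.union_disjoint finite_pairs prod.reindex[OF inj])
qed

text \<open>Two instances occur: the edge probability \<open>w\<close>, whose integral operator is
  studied, and \<open>1 - w\<close>, to which the container bound applies. Bounds and symmetry are
  required at all points, which avoids side conditions on membership in the space.\<close>

locale sym_kernel = prob_space M for M :: "'a measure" +
  fixes f :: "'a \<Rightarrow> 'a \<Rightarrow> real"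
  assumes kernel_measurable [measurable]: "(\<lambda>(x, y). f x y) \<in> borel_measurable (M \<Otimes>\<^sub>M M)"
    and kernel_nonneg: "0 \<le> f x y"
    and kernel_le_1: "f x y \<le> 1"
    and kernel_sym: "f x y = f y x"
begin

sublocale P: product_prob_space "\<lambda>_::nat. M" UNIV
  by unfold_locales

text \<open>A hard-core type weight: \<open>h\<close> is the activity of a single point,
  \<open>f\<close> the interaction of two. For \<open>h = 1\<close> and \<open>f = 1 - w\<close> it
  is the conditional probability, given the points, that no pair is an edge.\<close>

definition weight :: "nat set \<Rightarrow> ('a \<Rightarrow> real) \<Rightarrow> (nat \<Rightarrow> 'a) \<Rightarrow> real" where
  "weight I h x = (\<Prod>i\<in>I. h (x i)) * (\<Prod>e\<in>pairs I. f (x (Min e)) (x (Max e)))"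

lemma kernel_pair: "f (x (Min {i, j})) (x (Max {i, j})) = f (x i) (x (j::nat))"
  by (cases i j rule: linorder_cases) (auto simp: min_def max_def kernel_sym)

lemma kernel_measurable_Pi [measurable]:
  assumes "e \<in> pairs I"
  shows "(\<lambda>x. f (x (Min e)) (x (Max e))) \<in> borel_measurable (Pi\<^sub>M I (\<lambda>_. M))"
  using assms
proof (rule pairsE)
  fix i j assume "i \<in> I" "j \<in> I" and e: "Min e = i" "Max e = j"
  then show ?thesis
    unfolding e by measurable
qed

lemma weight_measurable [measurable]:
  assumes [measurable]: "h \<in> borel_measurable M"
  shows "weight I h \<in> borel_measurable (Pi\<^sub>M I (\<lambda>_. M))"
  unfolding weight_def by measurable

lemma weight_nonneg: "(\<And>x. 0 \<le> h x) \<Longrightarrow> 0 \<le> weight I h x"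
  by (auto simp: weight_def intro!: mult_nonneg_nonneg prod_nonneg kernel_nonneg)

lemma weight_le_prod: "(\<And>x. 0 \<le> h x) \<Longrightarrow> weight I h x \<le> (\<Prod>i\<in>I. h (x i))"
  unfolding weight_def
  by (intro mult_right_le_one_le prod_nonneg prod_le_1 conjI ballI kernel_nonneg kernel_le_1)

text \<open>Fixing the point at \<open>i\<close> multiplies the activity of every other point
  \<open>z\<close> by \<open>f y z\<close>. The family of weights is thus closed under conditioning,
  so the induction can run over all \<open>h\<close>.\<close>

lemma weight_insert:
  assumes "finite I" "i \<notin> I"
  shows "weight (insert i I) h (x(i := y)) = h y * weight I (\<lambda>z. h z * f y z) x"
proof -
  have *: "(\<Prod>e\<in>pairs I. f ((x(i := y)) (Min e)) ((x(i := y)) (Max e)))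
      = (\<Prod>e\<in>pairs I. f (x (Min e)) (x (Max e)))"
  proof (rule prod.cong[OF refl])
    fix e assume "e \<in> pairs I"
    then show "f ((x(i := y)) (Min e)) ((x(i := y)) (Max e)) = f (x (Min e)) (x (Max e))"
      using assms(2) by (elim pairsE) auto
  qed
  have "(\<Prod>j\<in>I. h ((x(i := y)) j)) = (\<Prod>j\<in>I. h (x j))"
    "(\<Prod>j\<in>I. f ((x(i := y)) (Min {i, j})) ((x(i := y)) (Max {i, j}))) = (\<Prod>j\<in>I. f y (x j))"
    unfolding kernel_pair using assms(2) by (auto intro!: prod.cong)
  then show ?thesis
    unfolding weight_def prod_pairs_insert[OF assms] prod.insert[OF assms] *
    by (simp add: prod.distrib algebra_simps)
qed

definition partition :: "nat set \<Rightarrow> ('a \<Rightarrow> real) \<Rightarrow> ennreal" where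
  "partition I h = (\<integral>\<^sup>+x. weight I h x \<partial>Pi\<^sub>M I (\<lambda>_. M))"

lemma nn_integral_weight_at:
  assumes "finite I" "i \<notin> I" and [measurable]: "h \<in> borel_measurable M" "D \<in> sets M"
    and h: "\<And>x. 0 \<le> h x"
  shows "(\<integral>\<^sup>+x. ennreal (weight (insert i I) h x) * indicator D (x i) \<partial>Pi\<^sub>M (insert i I) (\<lambda>_. M))
    = (\<integral>\<^sup>+y. ennreal (h y) * indicator D y * partition I (\<lambda>z. h z * f y z) \<partial>M)"
proof -
  have "(\<integral>\<^sup>+x. ennreal (weight (insert i I) h x) * indicator D (x i) \<partial>Pi\<^sub>M (insert i I) (\<lambda>_. M))
    = (\<integral>\<^sup>+y. \<integral>\<^sup>+x. ennreal (weight (insert i I) h (x(i := y))) * indicator D y \<partial>Pi\<^sub>M I (\<lambda>_. M) \<partial>M)"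
    by (subst P.product_nn_integral_insert_rev[OF assms(1,2)]) auto
  also have "\<dots> = (\<integral>\<^sup>+y. ennreal (h y) * indicator D y * partition I (\<lambda>z. h z * f y z) \<partial>M)"
  proof (rule nn_integral_cong)
    fix y assume [simp]: "y \<in> space M"
    have "(\<lambda>z. h z * f y z) \<in> borel_measurable M"
      by measurable
    note [measurable] = weight_measurable[OF this, of I]
    have "(\<integral>\<^sup>+x. ennreal (weight (insert i I) h (x(i := y))) * indicator D y \<partial>Pi\<^sub>M I (\<lambda>_. M))
      = (\<integral>\<^sup>+x. (ennreal (h y) * indicator D y) * ennreal (weight I (\<lambda>z. h z * f y z) x) \<partial>Pi\<^sub>M I (\<lambda>_. M))"
      using h by (intro nn_integral_cong)
        (simp add: weight_insert[OF assms(1,2)] ennreal_mult weight_nonneg kernel_nonneg algebra_simps)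
    also have "\<dots> = ennreal (h y) * indicator D y * partition I (\<lambda>z. h z * f y z)"
      by (subst nn_integral_cmult) (simp_all add: partition_def)
    finally show "(\<integral>\<^sup>+x. ennreal (weight (insert i I) h (x(i := y))) * indicator D y \<partial>Pi\<^sub>M I (\<lambda>_. M)) = \<dots>" .
  qed
  finally show ?thesis .
qed

lemma nn_integral_prod_const:
  assumes "finite (I :: nat set)" "g \<in> borel_measurable M"
  shows "(\<integral>\<^sup>+x. (\<Prod>i\<in>I. g (x i)) \<partial>Pi\<^sub>M I (\<lambda>_. M)) = (\<integral>\<^sup>+x. g x \<partial>M) ^ card I"
  using P.product_nn_integral_prod[OF assms(1), of "\<lambda>_. g"] assms(2) by simp

lemma partition_le_power:
  assumes "finite I" and [measurable]: "h \<in> borel_measurable M" and h: "\<And>x. 0 \<le> h x"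
  shows "partition I h \<le> (\<integral>\<^sup>+x. h x \<partial>M) ^ card I"
proof -
  have "partition I h \<le> (\<integral>\<^sup>+x. (\<Prod>i\<in>I. ennreal (h (x i))) \<partial>Pi\<^sub>M I (\<lambda>_. M))"
    unfolding partition_def
    by (intro nn_integral_mono) (simp add: prod_ennreal h weight_le_prod ennreal_leI)
  also have "\<dots> = (\<integral>\<^sup>+x. h x \<partial>M) ^ card I"
    using assms(1) by (rule nn_integral_prod_const) simp
  finally show ?thesis .
qed

text \<open>
  One round of the container argument: either every sampled point avoids \<open>D\<close>, or some point lies
  in \<open>D\<close>, and conditioning on it replaces the weight \<open>h\<close> by \<open>h \<cdot> f y\<close>.
\<close>

lemma partition_split:
  assumes "finite I" and [measurable]: "h \<in> borel_measurable M" "D \<in> sets M" and h: "\<And>x. 0 \<le> h x"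
  shows "partition I h \<le> (\<integral>\<^sup>+x. ennreal (h x) * indicator (space M - D) x \<partial>M) ^ card I
    + (\<Sum>i\<in>I. \<integral>\<^sup>+y. ennreal (h y) * indicator D y * partition (I - {i}) (\<lambda>z. h z * f y z) \<partial>M)"
proof -
  let ?P = "Pi\<^sub>M I (\<lambda>_. M)"
  have "ennreal (weight I h x) \<le> (\<Prod>i\<in>I. ennreal (h (x i)) * indicator (space M - D) (x i))
      + (\<Sum>i\<in>I. ennreal (weight I h x) * indicator D (x i))" if x: "x \<in> space ?P" for x
  proof (cases "\<exists>i\<in>I. x i \<in> D")
    case True
    then obtain i where i: "i \<in> I" "x i \<in> D" by blast
    have "ennreal (weight I h x) = ennreal (weight I h x) * indicator D (x i)"
      using i by simp
    also have "\<dots> \<le> (\<Sum>i\<in>I. ennreal (weight I h x) * indicator D (x i))"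
      by (rule member_le_sum) (use i assms(1) in auto)
    finally show ?thesis
      by (simp add: add_increasing)
  next
    case False
    then have "(\<Prod>i\<in>I. ennreal (h (x i)) * indicator (space M - D) (x i)) = ennreal (\<Prod>i\<in>I. h (x i))"
      using x by (auto simp: prod_ennreal[symmetric] h space_PiM PiE_iff intro!: prod.cong)
    then show ?thesis
      using weight_le_prod[of h I x] h by (simp add: add_increasing2 ennreal_leI)
  qed
  then have "partition I h \<le> (\<integral>\<^sup>+x. (\<Prod>i\<in>I. ennreal (h (x i)) * indicator (space M - D) (x i))
      + (\<Sum>i\<in>I. ennreal (weight I h x) * indicator D (x i)) \<partial>?P)"
    unfolding partition_def by (rule nn_integral_mono)
  also have "\<dots> = (\<integral>\<^sup>+x. (\<Prod>i\<in>I. ennreal (h (x i)) * indicator (space M - D) (x i)) \<partial>?P)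
      + (\<Sum>i\<in>I. \<integral>\<^sup>+x. ennreal (weight I h x) * indicator D (x i) \<partial>?P)"
    by (subst nn_integral_add) (auto simp: nn_integral_sum)
  also have "(\<integral>\<^sup>+x. (\<Prod>i\<in>I. ennreal (h (x i)) * indicator (space M - D) (x i)) \<partial>?P)
      = (\<integral>\<^sup>+x. ennreal (h x) * indicator (space M - D) x \<partial>M) ^ card I"
    using assms(1) by (rule nn_integral_prod_const) simp
  also have "(\<Sum>i\<in>I. \<integral>\<^sup>+x. ennreal (weight I h x) * indicator D (x i) \<partial>?P)
    = (\<Sum>i\<in>I. \<integral>\<^sup>+y. ennreal (h y) * indicator D y * partition (I - {i}) (\<lambda>z. h z * f y z) \<partial>M)"
  proof (rule sum.cong[OF refl])
    fix i assume "i \<in> I"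
    then show "(\<integral>\<^sup>+x. ennreal (weight I h x) * indicator D (x i) \<partial>?P)
      = (\<integral>\<^sup>+y. ennreal (h y) * indicator D y * partition (I - {i}) (\<lambda>z. h z * f y z) \<partial>M)"
      using nn_integral_weight_at[of "I - {i}" i h D] assms by (simp add: insert_absorb)
  qed
  finally show ?thesis .
qed

text \<open>Here \<open>1 - f\<close> is the edge probability, so for \<open>f = 1 - w\<close> this
  is the quadratic form of \<open>w\<close> at \<open>g\<close>.\<close>

definition energy :: "('a \<Rightarrow> real) \<Rightarrow> ennreal" where
  "energy g = (\<integral>\<^sup>+x. \<integral>\<^sup>+y. ennreal (g x * g y * (1 - f x y)) \<partial>M \<partial>M)"

text \<open>Induction on \<open>m\<close>, which bounds how often the integral of the activity can
  drop by \<open>d\<close>. A round costs a factor \<open>card I\<close> for the choice of the point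
  in \<open>D\<close>, and a factor \<open>max 1 (1 / b)\<close> because the exponent of
  \<open>b\<close> falls by one; the \<open>+ 1\<close> leaves room for the case in which all points
  avoid \<open>D\<close>.\<close>

lemma partition_bound:
  assumes d: "0 < d" and b: "0 < b"
    and container: "\<And>g. g \<in> borel_measurable M \<Longrightarrow> (\<And>x. 0 \<le> g x) \<Longrightarrow> (\<And>x. g x \<le> 1) \<Longrightarrow>
      energy g \<le> ennreal d \<Longrightarrow> (\<integral>\<^sup>+x. g x \<partial>M) \<le> ennreal b"
    and "finite I" "h \<in> borel_measurable M" "\<And>x. 0 \<le> h x" "\<And>x. h x \<le> 1"
    and "(\<integral>\<^sup>+x. h x \<partial>M) \<le> ennreal (real m * d)"
  shows "partition I h \<le> ennreal (((real (card I) + 1) * max 1 (1 / b)) ^ m * b ^ card I)"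
  using assms(4-)
proof (induction m arbitrary: I h)
  case 0
  \<comment> \<open>For \<open>m = 0\<close> the integral of \<open>h\<close> is 0, hence below
    \<open>b\<close>; comparing powers with equal exponents also covers empty
    \<open>I\<close>.\<close>
  have "partition I h \<le> (\<integral>\<^sup>+x. h x \<partial>M) ^ card I"
    using 0 by (intro partition_le_power) auto
  also have "\<dots> \<le> ennreal b ^ card I"
    using 0 by (intro power_mono) auto
  finally show ?case
    using b by (simp add: ennreal_power)
next
  case (Suc m)
  note [measurable] = Suc.prems(2)
  define n where "n = card I"
  define c where "c = max 1 (1 / b)"
  have c: "1 \<le> c" "1 \<le> c * b"
    using b by (auto simp: c_def max_def field_simps)
  \<comment> \<open>The degree is taken with respect to the current \<open>h\<close>, so
    conditioning on a point of \<open>D\<close> removes mass that is still present.\<close>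
  define D where "D = {x \<in> space M. ennreal d \<le> (\<integral>\<^sup>+y. ennreal (h y * (1 - f x y)) \<partial>M)}"
  have [measurable]: "D \<in> sets M"
    unfolding D_def by measurable
  define g where "g = (\<lambda>x. h x * indicator (space M - D) x)"
  have g[measurable]: "g \<in> borel_measurable M" and g0: "0 \<le> g x" and g1: "g x \<le> 1" and gh: "g x \<le> h x" for x
    using Suc.prems(3,4)[of x] by (auto simp: g_def indicator_def)
  \<comment> \<open>A point outside \<open>D\<close> has degree below \<open>d\<close> in
    \<open>h\<close>, hence also in the smaller \<open>g\<close>, and \<open>g\<close> vanishes on
    \<open>D\<close>.\<close>
  have "energy g \<le> (\<integral>\<^sup>+x. ennreal d \<partial>M)"
    unfolding energy_def
  proof (rule nn_integral_mono)
    fix x assume x: "x \<in> space M"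
    show "(\<integral>\<^sup>+y. ennreal (g x * g y * (1 - f x y)) \<partial>M) \<le> ennreal d"
    proof (cases "x \<in> D")
      case False
      have "(\<integral>\<^sup>+y. ennreal (g x * g y * (1 - f x y)) \<partial>M) \<le> (\<integral>\<^sup>+y. ennreal (h y * (1 - f x y)) \<partial>M)"
      proof (intro nn_integral_mono ennreal_leI)
        fix y
        have "g x * g y \<le> 1 * h y"
          by (intro mult_mono g1 gh g0) simp
        then show "g x * g y * (1 - f x y) \<le> h y * (1 - f x y)"
          using kernel_le_1[of x y] by (intro mult_right_mono) auto
      qed
      also have "\<dots> \<le> ennreal d"
        using False x by (auto simp: D_def)
      finally show ?thesis .
    qed (simp add: g_def)
  qed
  also have "\<dots> = ennreal d"
    by (simp add: emeasure_space_1)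
  finally have "(\<integral>\<^sup>+x. g x \<partial>M) \<le> ennreal b"
    by (intro container g g0 g1)
  then have 1: "(\<integral>\<^sup>+x. ennreal (h x) * indicator (space M - D) x \<partial>M) \<le> ennreal b"
    using Suc.prems(3) by (simp add: g_def ennreal_mult ennreal_indicator)
  have 2: "(\<integral>\<^sup>+y. ennreal (h y) * indicator D y * partition (I - {i}) (\<lambda>z. h z * f y z) \<partial>M)
      \<le> ennreal ((real n * c) ^ m * b ^ (n - 1))" if i: "i \<in> I" for i
  proof -
    let ?B = "ennreal ((real n * c) ^ m * b ^ (n - 1))"
    have n: "card (I - {i}) = n - 1" "1 \<le> n"
      using i Suc.prems(1) by (auto simp: n_def Suc_le_eq card_gt_0_iff)
    have "ennreal (h y) * indicator D y * partition (I - {i}) (\<lambda>z. h z * f y z) \<le> ?B"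
      if y: "y \<in> space M" for y
    proof (cases "y \<in> D")
      case True
      have [measurable]: "(\<lambda>z. h z * f y z) \<in> borel_measurable M"
        using y by measurable
      \<comment> \<open>Conditioning on \<open>y\<close> keeps the part \<open>f y z\<close> of the
        activity and loses the part \<open>1 - f y z\<close>, whose integral is at least
        \<open>d\<close> because \<open>y\<close> is in \<open>D\<close>.\<close>
      have "ennreal (h z * f y z) + ennreal (h z * (1 - f y z)) = ennreal (h z)" for z
      proof -
        have "0 \<le> h z * f y z" "0 \<le> h z * (1 - f y z)"
          using Suc.prems(3)[of z] kernel_le_1[of y z] kernel_nonneg[of y z] by simp_all
        then have "ennreal (h z * f y z) + ennreal (h z * (1 - f y z)) = ennreal (h z * f y z + h z * (1 - f y z))"
          by (rule ennreal_plus[symmetric])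
        then show ?thesis by (simp add: algebra_simps)
      qed
      then have "(\<integral>\<^sup>+z. ennreal (h z * f y z) \<partial>M) + (\<integral>\<^sup>+z. ennreal (h z * (1 - f y z)) \<partial>M) = (\<integral>\<^sup>+z. h z \<partial>M)"
        using y by (subst nn_integral_add[symmetric]) auto
      then have "(\<integral>\<^sup>+z. ennreal (h z * f y z) \<partial>M) + ennreal d \<le> (\<integral>\<^sup>+z. h z \<partial>M)"
        using True by (auto simp: D_def intro: add_left_mono dest: add_left_mono[where c="\<integral>\<^sup>+z. ennreal (h z * f y z) \<partial>M"])
      also have "\<dots> \<le> ennreal (real m * d) + ennreal d"
        using Suc.prems(5) d by (simp add: ennreal_plus[symmetric] algebra_simps del: ennreal_plus)
      finally have "(\<integral>\<^sup>+z. ennreal (h z * f y z) \<partial>M) \<le> ennreal (real m * d)"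
        by (simp add: ennreal_add_left_cancel_le add.commute)
      then have "partition (I - {i}) (\<lambda>z. h z * f y z)
          \<le> ennreal (((real (card (I - {i})) + 1) * max 1 (1 / b)) ^ m * b ^ card (I - {i}))"
        using Suc.prems kernel_nonneg kernel_le_1 by (intro Suc.IH) (auto intro!: mult_le_one)
      also have "\<dots> = ?B"
        using n by (simp add: c_def of_nat_diff)
      finally have *: "partition (I - {i}) (\<lambda>z. h z * f y z) \<le> ?B" .
      have "ennreal (h y) * indicator D y * partition (I - {i}) (\<lambda>z. h z * f y z) \<le> 1 * ?B"
        using True Suc.prems(4)[of y] by (intro mult_mono *) (auto simp: ennreal_le_1)
      then show ?thesis by simp
    qed simp
    then have "(\<integral>\<^sup>+y. ennreal (h y) * indicator D y * partition (I - {i}) (\<lambda>z. h z * f y z) \<partial>M) \<le> (\<integral>\<^sup>+y. ?B \<partial>M)"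
      by (rule nn_integral_mono)
    then show ?thesis
      by (simp add: emeasure_space_1)
  qed
  \<comment> \<open>In the sum over the points, \<open>c * b \<ge> 1\<close> restores the lost
    factor \<open>b\<close>; for \<open>n = 0\<close>, where \<open>n - 1\<close> is truncated, the
    factor \<open>n\<close> vanishes. The extra \<open>b ^ n\<close> fits because
    \<open>n ^ Suc m + 1 \<le> (n + 1) ^ Suc m\<close>.\<close>
  have arith: "b ^ n + real n * ((real n * c) ^ m * b ^ (n - 1)) \<le> ((real n + 1) * c) ^ Suc m * b ^ n"
  proof -
    have "real n * ((real n * c) ^ m * b ^ (n - 1)) \<le> (real n * c) ^ Suc m * b ^ n"
    proof (cases n)
      case (Suc k)
      have "real n * ((real n * c) ^ m * b ^ (n - 1)) * 1 \<le> real n * ((real n * c) ^ m * b ^ (n - 1)) * (c * b)"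
        using c b by (intro mult_left_mono) auto
      then show ?thesis
        by (simp add: Suc algebra_simps)
    qed simp
    moreover have "(real n * c) ^ Suc m + 1 \<le> ((real n + 1) * c) ^ Suc m"
    proof -
      have "(real n) ^ Suc m + 1 \<le> (real n + 1) ^ Suc m"
      proof -
        have "real n * real n ^ m + 1 \<le> real n * (real n + 1) ^ m + (real n + 1) ^ m"
          by (intro add_mono mult_left_mono power_mono one_le_power) auto
        then show ?thesis by (simp add: algebra_simps)
      qed
      then have "((real n) ^ Suc m + 1) * c ^ Suc m \<le> (real n + 1) ^ Suc m * c ^ Suc m"
        using c by (intro mult_right_mono) auto
      moreover have "1 \<le> c ^ Suc m"
        using c by (intro one_le_power)
      moreover have "((real n) ^ Suc m + 1) * c ^ Suc m = (real n * c) ^ Suc m + c ^ Suc m"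
        by (simp only: power_mult_distrib distrib_right mult_1)
      ultimately show ?thesis
        unfolding power_mult_distrib[symmetric] by linarith
    qed
    then have "((real n * c) ^ Suc m + 1) * b ^ n \<le> ((real n + 1) * c) ^ Suc m * b ^ n"
      using b by (intro mult_right_mono) auto
    then have "(real n * c) ^ Suc m * b ^ n + b ^ n \<le> ((real n + 1) * c) ^ Suc m * b ^ n"
      by (simp only: distrib_right[of "(real n * c) ^ Suc m"] mult_1)
    ultimately show ?thesis by linarith
  qed
  have "partition I h \<le> (\<integral>\<^sup>+x. ennreal (h x) * indicator (space M - D) x \<partial>M) ^ card I
    + (\<Sum>i\<in>I. \<integral>\<^sup>+y. ennreal (h y) * indicator D y * partition (I - {i}) (\<lambda>z. h z * f y z) \<partial>M)"
    using Suc.prems by (intro partition_split) auto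
  also have "\<dots> \<le> ennreal b ^ n + (\<Sum>i\<in>I. ennreal ((real n * c) ^ m * b ^ (n - 1)))"
    unfolding n_def[symmetric] by (intro add_mono power_mono sum_mono 1 2) auto
  also have "\<dots> = ennreal (b ^ n + real n * ((real n * c) ^ m * b ^ (n - 1)))"
    using b c by (simp add: ennreal_power ennreal_mult[symmetric] ennreal_of_nat_eq_real_of_nat n_def[symmetric]
         ennreal_plus[symmetric] del: ennreal_plus)
  also have "\<dots> \<le> ennreal (((real n + 1) * c) ^ Suc m * b ^ n)"
    by (rule ennreal_leI[OF arith])
  finally show ?case
    by (simp only: n_def c_def)
qed

end

section \<open>Functions of vanishing energy\<close>

abbreviation unit_lebesgue :: "real measure" where
  "unit_lebesgue \<equiv> lebesgue_on {0..1}"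

lemma prob_space_unit_lebesgue: "prob_space unit_lebesgue"
  by (rule prob_spaceI) (simp add: emeasure_restrict_space)

interpretation unit: prob_space unit_lebesgue
  by (rule prob_space_unit_lebesgue)

lemma measure_unit_interval [simp]: "measure unit_lebesgue {0..1} = 1"
  using unit.prob_space by simp

interpretation unit2: pair_prob_space unit_lebesgue unit_lebesgue
  by unfold_locales

section \<open>Weak sequential compactness of functions with values in \<open>[0, 1]\<close>\<close>

lemma (in prob_space) integrable_unit_bounded:
  fixes g :: "'a \<Rightarrow> real"
  assumes "g \<in> borel_measurable M" "\<And>x. 0 \<le> g x" "\<And>x. g x \<le> 1"
  shows "integrable M g"
  using assms by (intro integrable_const_bound[where B=1]) auto

lemma borel_measurable_real_polynomial_function:
  fixes p :: "real \<Rightarrow> real"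
  assumes "real_polynomial_function p"
  shows "p \<in> borel_measurable unit_lebesgue"
proof -
  have "continuous_on UNIV p"
    using assms by (intro continuous_at_imp_continuous_on ballI continuous_real_polymonial_function)
  then have "p \<in> borel_measurable borel"
    by (rule borel_measurable_continuous_onI)
  then show ?thesis
    by (intro measurable_restrict_space1 measurable_completion) simp
qed

text \<open>Density of polynomials in \<open>L^1\<close>: a measurable function is an almost
  everywhere limit of continuous ones, and these are uniformly close to polynomials on
  \<open>{0..1}\<close>.\<close>

lemma unit_polynomial_approx:
  fixes \<phi> :: "real \<Rightarrow> real"
  assumes \<phi>[measurable]: "\<phi> \<in> borel_measurable unit_lebesgue"
    and "\<And>x. 0 \<le> \<phi> x" "\<And>x. \<phi> x \<le> 1" and "0 < e"
  obtains p where "real_polynomial_function p" "(\<integral>x. \<bar>\<phi> x - p x\<bar> \<partial>unit_lebesgue) < e"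
proof -
  have "\<phi> measurable_on {0..1}"
    using \<phi> by (simp add: measurable_on_iff_borel_measurable)
  then obtain N g where N: "negligible N" and g: "\<And>n. continuous_on UNIV (g n)"
    and lim: "\<And>x. x \<notin> N \<Longrightarrow> (\<lambda>n. g n x) \<longlonglongrightarrow> (if x \<in> {0..1} then \<phi> x else 0)"
    unfolding measurable_on_def by blast
  \<comment> \<open>Clipping keeps the limit, as \<open>\<phi>\<close> has values in
    \<open>[0, 1]\<close>, and makes domination by the constant 1 possible.\<close>
  define c where "c = (\<lambda>n x. max 0 (min 1 (g n x)) :: real)"
  have c_cont: "continuous_on UNIV (c n)" for n
    unfolding c_def by (intro continuous_intros g)
  have c01: "0 \<le> c n x" "c n x \<le> 1" for n x
    by (auto simp: c_def)
  have c_meas [measurable]: "c n \<in> borel_measurable unit_lebesgue" for n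
    using borel_measurable_continuous_onI[OF c_cont]
    by (intro measurable_restrict_space1 measurable_completion) simp
  have "AE x in lebesgue. x \<notin> N"
    using N by (intro AE_not_in) (simp add: negligible_iff_null_sets)
  then have "AE x in unit_lebesgue. x \<notin> N"
    by (auto simp: AE_restrict_space_iff elim: eventually_mono)
  then have ae: "AE x in unit_lebesgue. (\<lambda>n. \<bar>\<phi> x - c n x\<bar>) \<longlonglongrightarrow> 0"
  proof (rule AE_mp, intro AE_I2 impI)
    fix x assume x: "x \<in> space unit_lebesgue" "x \<notin> N"
    then have "(\<lambda>n. c n x) \<longlonglongrightarrow> max 0 (min 1 (\<phi> x))"
      unfolding c_def using lim[of x] by (intro tendsto_intros) simp
    then have "(\<lambda>n. \<bar>\<phi> x - c n x\<bar>) \<longlonglongrightarrow> \<bar>\<phi> x - \<phi> x\<bar>"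
      using assms(2,3)[of x] by (intro tendsto_intros) simp
    then show "(\<lambda>n. \<bar>\<phi> x - c n x\<bar>) \<longlonglongrightarrow> 0"
      by simp
  qed
  have bnd: "\<bar>\<phi> x - c n x\<bar> \<le> 1" for n x
    using assms(2,3)[of x] c01[of n x] by auto
  have "(\<lambda>n. \<integral>x. \<bar>\<phi> x - c n x\<bar> \<partial>unit_lebesgue) \<longlonglongrightarrow> (\<integral>x. 0 \<partial>unit_lebesgue)"
    using ae bnd by (intro integral_dominated_convergence[where w="\<lambda>_. 1"]) auto
  then have "eventually (\<lambda>n. (\<integral>x. \<bar>\<phi> x - c n x\<bar> \<partial>unit_lebesgue) < e / 2) sequentially"
    using \<open>0 < e\<close> by (intro order_tendstoD) auto
  then obtain n where n: "(\<integral>x. \<bar>\<phi> x - c n x\<bar> \<partial>unit_lebesgue) < e / 2"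
    by (meson eventually_sequentially order_refl)
  obtain p where p: "real_polynomial_function p" "\<And>x. x \<in> {0..1} \<Longrightarrow> \<bar>c n x - p x\<bar> < e / 2"
    by (rule Stone_Weierstrass_real_polynomial_function[of "{0..1}" "c n" "e / 2"])
      (use \<open>0 < e\<close> continuous_on_subset[OF c_cont] in auto)
  have p_meas [measurable]: "p \<in> borel_measurable unit_lebesgue"
    using p(1) by (rule borel_measurable_real_polynomial_function)
  have "(\<integral>x. \<bar>\<phi> x - p x\<bar> \<partial>unit_lebesgue) \<le> (\<integral>x. \<bar>\<phi> x - c n x\<bar> + e / 2 \<partial>unit_lebesgue)"
  proof (rule integral_mono_AE')
    show "integrable unit_lebesgue (\<lambda>x. \<bar>\<phi> x - c n x\<bar> + e / 2)"
      using bnd by (intro Bochner_Integration.integrable_add[OF unit.integrable_unit_bounded]) auto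
    show "AE x in unit_lebesgue. \<bar>\<phi> x - p x\<bar> \<le> \<bar>\<phi> x - c n x\<bar> + e / 2"
    proof (rule AE_I2)
      fix x assume "x \<in> space unit_lebesgue"
      then have "\<bar>c n x - p x\<bar> < e / 2"
        by (intro p(2)) simp
      then show "\<bar>\<phi> x - p x\<bar> \<le> \<bar>\<phi> x - c n x\<bar> + e / 2"
        by linarith
    qed
  qed (use \<open>0 < e\<close> in auto)
  also have "\<dots> = (\<integral>x. \<bar>\<phi> x - c n x\<bar> \<partial>unit_lebesgue) + e / 2"
    using bnd by (subst Bochner_Integration.integral_add[OF unit.integrable_unit_bounded]) auto
  also have "\<dots> < e"
    using n by simp
  finally show thesis
    using p(1) that by blast
qed

lemma convergent_if_uniformly_close:
  fixes a :: "nat \<Rightarrow> real"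
  assumes "\<And>e. 0 < e \<Longrightarrow> \<exists>b. convergent b \<and> (\<forall>n. \<bar>a n - b n\<bar> \<le> e)"
  shows "convergent a"
proof (rule Cauchy_convergent, rule metric_CauchyI)
  fix e :: real assume "0 < e"
  then obtain b where b: "convergent b" "\<And>n. \<bar>a n - b n\<bar> \<le> e / 4"
    using assms[of "e / 4"] by auto
  then obtain N where N: "\<And>m n. m \<ge> N \<Longrightarrow> n \<ge> N \<Longrightarrow> dist (b m) (b n) < e / 2"
    using \<open>0 < e\<close> metric_CauchyD[OF convergent_Cauchy[OF b(1)], of "e / 2"] by auto
  have "dist (a m) (a n) < e" if "m \<ge> N" "n \<ge> N" for m n
  proof -
    have "\<bar>b m - b n\<bar> < e / 2"
      using N that by (simp add: dist_real_def)
    then show ?thesis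
      using b(2)[of m] b(2)[of n] unfolding dist_real_def by linarith
  qed
  then show "\<exists>N. \<forall>m\<ge>N. \<forall>n\<ge>N. dist (a m) (a n) < e"
    by blast
qed

text \<open>Linearity gives convergence against polynomials. Replacing \<open>\<phi>\<close> by a
  polynomial changes each integral by at most their \<open>L^1\<close> distance, uniformly in
  \<open>n\<close> since \<open>g n\<close> is bounded by 1.\<close>

lemma convergent_integrals_of_moments:
  fixes g :: "nat \<Rightarrow> real \<Rightarrow> real"
  assumes [measurable]: "\<And>n. g n \<in> borel_measurable unit_lebesgue"
    and g: "\<And>n x. 0 \<le> g n x" "\<And>n x. g n x \<le> 1"
    and moments: "\<And>j::nat. convergent (\<lambda>n. \<integral>x. x ^ j * g n x \<partial>unit_lebesgue)"
    and [measurable]: "\<phi> \<in> borel_measurable unit_lebesgue"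
    and \<phi>: "\<And>x. 0 \<le> \<phi> x" "\<And>x. \<phi> x \<le> 1"
  shows "convergent (\<lambda>n. \<integral>x. \<phi> x * g n x \<partial>unit_lebesgue)"
proof (rule convergent_if_uniformly_close)
  fix e :: real assume "0 < e"
  obtain p where p: "real_polynomial_function p" "(\<integral>x. \<bar>\<phi> x - p x\<bar> \<partial>unit_lebesgue) < e"
    by (rule unit_polynomial_approx[of \<phi> e]) (use \<phi> \<open>0 < e\<close> in auto)
  have p_cont: "continuous_on UNIV p"
    using p(1) by (intro continuous_at_imp_continuous_on ballI continuous_real_polymonial_function)
  then have p_meas [measurable]: "p \<in> borel_measurable unit_lebesgue"
    using p(1) by (intro borel_measurable_real_polynomial_function)
  have pow_meas [measurable]: "(\<lambda>x::real. x) \<in> borel_measurable unit_lebesgue"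
    by (intro measurable_restrict_space1 measurable_completion) simp
  obtain a m where p_eq: "p = (\<lambda>x. \<Sum>i\<le>m. a i * x ^ i)"
    using p(1) by (auto simp: real_polynomial_function_iff_sum)
  have int_pow: "integrable unit_lebesgue (\<lambda>x. x ^ i * g n x)" for i n
    using g by (intro unit.integrable_const_bound[where B=1] AE_I2)
      (auto simp: abs_mult intro!: mult_le_one power_le_one)
  have "bounded (p ` {0..1})"
    by (intro compact_imp_bounded compact_continuous_image continuous_on_subset[OF p_cont]) auto
  then obtain B where B: "\<And>x. x \<in> {0..1} \<Longrightarrow> \<bar>p x\<bar> \<le> B"
    unfolding bounded_iff by (auto simp: image_iff) (metis atLeastAtMost_iff)
  have int_p: "integrable unit_lebesgue p"
    using B by (intro unit.integrable_const_bound[where B=B]) auto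
  have int_\<phi>: "integrable unit_lebesgue \<phi>"
    using \<phi> by (intro unit.integrable_unit_bounded) auto
  have int_\<phi>g: "integrable unit_lebesgue (\<lambda>x. \<phi> x * g n x)" for n
    using \<phi> g by (intro unit.integrable_unit_bounded) (auto intro: mult_le_one)
  have int_pg: "integrable unit_lebesgue (\<lambda>x. p x * g n x)" for n
    unfolding p_eq sum_distrib_right mult.assoc
    by (intro Bochner_Integration.integrable_sum integrable_mult_right int_pow)
  show "\<exists>b. convergent b \<and> (\<forall>n. \<bar>(\<integral>x. \<phi> x * g n x \<partial>unit_lebesgue) - b n\<bar> \<le> e)"
  proof (intro exI[of _ "\<lambda>n. \<integral>x. p x * g n x \<partial>unit_lebesgue"] conjI allI)
    have "(\<integral>x. p x * g n x \<partial>unit_lebesgue) = (\<Sum>i\<le>m. a i * (\<integral>x. x ^ i * g n x \<partial>unit_lebesgue))" for n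
      unfolding p_eq sum_distrib_right mult.assoc
      by (subst Bochner_Integration.integral_sum) (auto intro!: int_pow)
    then show "convergent (\<lambda>n. \<integral>x. p x * g n x \<partial>unit_lebesgue)"
      by (simp, intro convergent_sum convergent_mult convergent_const moments)
    fix n
    have "\<bar>(\<integral>x. \<phi> x * g n x \<partial>unit_lebesgue) - (\<integral>x. p x * g n x \<partial>unit_lebesgue)\<bar>
        = \<bar>\<integral>x. (\<phi> x - p x) * g n x \<partial>unit_lebesgue\<bar>"
      by (subst Bochner_Integration.integral_diff[symmetric]) (auto simp: int_\<phi>g int_pg algebra_simps)
    also have "\<dots> \<le> (\<integral>x. \<bar>(\<phi> x - p x) * g n x\<bar> \<partial>unit_lebesgue)"
      by (rule integral_abs_bound)
    also have "\<dots> \<le> (\<integral>x. \<bar>\<phi> x - p x\<bar> \<partial>unit_lebesgue)"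
      using g int_p int_\<phi> by (intro integral_mono') (auto simp: abs_mult mult_left_le)
    finally show "\<bar>(\<integral>x. \<phi> x * g n x \<partial>unit_lebesgue) - (\<integral>x. p x * g n x \<partial>unit_lebesgue)\<bar> \<le> e"
      using p(2) by simp
  qed
qed

text \<open>Tychonoff replaces a diagonal extraction: a countable power of \<open>[0, 1]\<close> is
  compact and first countable, hence sequentially compact.\<close>

lemma convergent_subseq_coordinatewise:
  fixes a :: "nat \<Rightarrow> nat \<Rightarrow> real"
  assumes "\<And>n j. a n j \<in> {0..1}"
  obtains r :: "nat \<Rightarrow> nat" where "strict_mono r" "\<And>j. convergent (\<lambda>n. a (r n) j)"
proof -
  have "compact (PiE UNIV (\<lambda>_::nat. {0..1::real}))"
    using compactin_PiE[of "\<lambda>_::nat. euclidean :: real topology" UNIV "\<lambda>_. {0..1}"]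
    by (simp add: euclidean_product_topology)
  then have "seq_compact (PiE UNIV (\<lambda>_::nat. {0..1::real}))"
    by (rule compact_imp_seq_compact)
  moreover have "\<forall>n. a n \<in> PiE UNIV (\<lambda>_. {0..1})"
    using assms by auto
  ultimately obtain l r where r: "strict_mono (r::nat\<Rightarrow>nat)" "(a \<circ> r) \<longlonglongrightarrow> l"
    by (rule seq_compactE)
  have "(\<lambda>n. a (r n) j) \<longlonglongrightarrow> l j" for j
    using continuous_on_tendsto_compose[OF continuous_on_product_coordinates r(2), of j]
    by (auto simp: o_def)
  then show thesis
    using r(1) that by (auto simp: convergent_def)
qed

text \<open>The moments lie in \<open>[0, 1]\<close>, so one subsequence makes all of them converge.
  Weak convergence is expressed by the tested integrals, without naming a limit function.\<close>

lemma weakly_convergent_subseq: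
  fixes g :: "nat \<Rightarrow> real \<Rightarrow> real"
  assumes [measurable]: "\<And>n. g n \<in> borel_measurable unit_lebesgue"
    and g: "\<And>n x. 0 \<le> g n x" "\<And>n x. g n x \<le> 1"
  obtains r :: "nat \<Rightarrow> nat" where "strict_mono r"
    "\<And>\<phi>. \<phi> \<in> borel_measurable unit_lebesgue \<Longrightarrow> (\<And>x. 0 \<le> \<phi> x) \<Longrightarrow> (\<And>x. \<phi> x \<le> 1) \<Longrightarrow>
      convergent (\<lambda>n. \<integral>x. \<phi> x * g (r n) x \<partial>unit_lebesgue)"
proof -
  have pow_meas [measurable]: "(\<lambda>x::real. x) \<in> borel_measurable unit_lebesgue"
    by (intro measurable_restrict_space1 measurable_completion) simp
  have "(\<integral>x. x ^ j * g n x \<partial>unit_lebesgue) \<in> {0..1}" for n and j :: nat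
  proof -
    have "0 \<le> (\<integral>x. x ^ j * g n x \<partial>unit_lebesgue)"
      using g by (intro integral_nonneg_AE AE_I2) auto
    moreover have "(\<integral>x. x ^ j * g n x \<partial>unit_lebesgue) \<le> (\<integral>x. 1 \<partial>unit_lebesgue)"
      using g by (intro integral_mono') (auto intro!: mult_le_one power_le_one)
    ultimately show ?thesis
      by simp
  qed
  then obtain r :: "nat \<Rightarrow> nat" where "strict_mono r"
    "\<And>j. convergent (\<lambda>n. \<integral>x. x ^ j * g (r n) x \<partial>unit_lebesgue)"
    by (rule convergent_subseq_coordinatewise[where a="\<lambda>n j. \<integral>x. x ^ j * g n x \<partial>unit_lebesgue"]) blast
  then show thesis
    by (intro that[of r]) (simp_all add: convergent_integrals_of_moments g)
qed

text \<open>Indices are chosen greedily. Asking for smallness in all rows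
  \<open>i \<le> r j\<close>, not only in those chosen before, makes each choice depend on the last
  index alone, so that dependent choice applies.\<close>

lemma double_seq_subseq:
  fixes a :: "nat \<Rightarrow> nat \<Rightarrow> real" and c :: "nat \<Rightarrow> real"
  assumes a: "\<And>i. a i \<longlonglongrightarrow> 0" and c: "c \<longlonglongrightarrow> 0"
  obtains r :: "nat \<Rightarrow> nat" where "strict_mono r" "\<And>j. c (r j) \<le> (1/4) ^ j"
    "\<And>i j. i < j \<Longrightarrow> a (r i) (r j) \<le> (1/4) ^ j"
proof -
  have ev: "\<exists>n>m. c n \<le> (1/4) ^ j \<and> (\<forall>i\<le>m. a i n \<le> (1/4) ^ j)" for m j :: nat
  proof -
    have "\<forall>\<^sub>F n in sequentially. c n < (1/4) ^ j"
      using c by (rule order_tendstoD) simp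
    moreover have "\<forall>\<^sub>F n in sequentially. \<forall>i\<in>{..m}. a i n < (1/4) ^ j"
      by (intro eventually_ball_finite ballI order_tendstoD(2)[OF a]) simp_all
    moreover have "\<forall>\<^sub>F n in sequentially. m < n"
      by (rule eventually_gt_at_top)
    ultimately have "\<forall>\<^sub>F n in sequentially. m < n \<and> c n \<le> (1/4) ^ j \<and> (\<forall>i\<le>m. a i n \<le> (1/4) ^ j)"
      by eventually_elim (auto simp: less_imp_le)
    then show ?thesis
      using eventually_happens'[OF sequentially_bot] by fast
  qed
  have "\<exists>r. \<forall>j. c (r j) \<le> (1/4) ^ j \<and> (r j < r (Suc j) \<and> (\<forall>i\<le>r j. a i (r (Suc j)) \<le> (1/4) ^ Suc j))"
  proof (rule dependent_nat_choice)
    show "\<exists>n. c n \<le> (1/4) ^ 0"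
      using ev[of 0 0] by blast
    show "\<exists>n. c n \<le> (1/4) ^ Suc j \<and> (m < n \<and> (\<forall>i\<le>m. a i n \<le> (1/4) ^ Suc j))" for m j
      using ev[of m "Suc j"] by blast
  qed
  then obtain r :: "nat \<Rightarrow> nat" where r: "\<And>j. c (r j) \<le> (1/4) ^ j" "\<And>j. r j < r (Suc j)"
    "\<And>j i. i \<le> r j \<Longrightarrow> a i (r (Suc j)) \<le> (1/4) ^ Suc j"
    by auto
  have mono: "strict_mono r"
    using r(2) by (simp add: strict_mono_Suc_iff)
  have "a (r i) (r j) \<le> (1/4) ^ j" if "i < j" for i j
  proof -
    have "i \<le> j - 1" "Suc (j - 1) = j"
      using that by auto
    then show ?thesis
      using r(3)[of "r i" "j - 1"] mono by (simp add: strict_mono_less_eq)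
  qed
  then show thesis
    using that mono r(1) by blast
qed

lemma limsup_eq_0_if_suminf_finite:
  fixes f :: "nat \<Rightarrow> ennreal"
  assumes "(\<Sum>j. f j) \<noteq> \<top>"
  shows "limsup f = 0"
proof -
  have nt: "f j \<noteq> \<top>" for j
    using assms ennreal_suminf_lessD[of f \<top> j] unfolding less_top by blast
  then have f: "(\<lambda>j. ennreal (enn2real (f j))) = f" 
    by (intro ext ennreal_enn2real) (simp add: less_top[symmetric])
  have "summable (\<lambda>j. enn2real (f j))"
    using assms by (intro summable_suminf_not_top) (simp_all only: f enn2real_nonneg not_False_eq_True)
  then have "(\<lambda>j. ennreal (enn2real (f j))) \<longlonglongrightarrow> ennreal 0"
    by (intro tendsto_ennrealI summable_LIMSEQ_zero)
  then have "f \<longlonglongrightarrow> 0"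
    unfolding f ennreal_0 .
  then show ?thesis
    by (intro lim_imp_Limsup) simp_all
qed

section \<open>The integral operator of the kernel, and independent sets from vanishing
  energy\<close>

locale unit_kernel = sym_kernel unit_lebesgue w for w
begin

definition T :: "(real \<Rightarrow> real) \<Rightarrow> real \<Rightarrow> real" where
  "T k x = (\<integral>y. w x y * k y \<partial>unit_lebesgue)"

lemma T_measurable [measurable]:
  assumes [measurable]: "k \<in> borel_measurable unit_lebesgue"
  shows "T k \<in> borel_measurable unit_lebesgue"
  unfolding T_def by measurable

lemma T_nonneg: "(\<And>x. 0 \<le> k x) \<Longrightarrow> 0 \<le> T k x"
  unfolding T_def by (intro integral_nonneg_AE AE_I2 mult_nonneg_nonneg kernel_nonneg)

lemma T_le_1:
  assumes "\<And>x. 0 \<le> k x" "\<And>x. k x \<le> 1"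
  shows "T k x \<le> 1"
proof -
  have "T k x \<le> (\<integral>y. 1 \<partial>unit_lebesgue)"
    unfolding T_def using assms kernel_nonneg kernel_le_1 by (intro integral_mono') (auto intro: mult_le_one)
  then show ?thesis by simp
qed

text \<open>Connects the \<open>ennreal\<close> double integrals, in which energies are stated, to
  the real bilinear form of \<open>T\<close>, for which limits are taken.\<close>

lemma nn_integral_kernel:
  assumes [measurable]: "h \<in> borel_measurable unit_lebesgue" "k \<in> borel_measurable unit_lebesgue"
    and h: "\<And>x. 0 \<le> h x" "\<And>x. h x \<le> 1" and k: "\<And>x. 0 \<le> k x" "\<And>x. k x \<le> 1"
  shows "(\<integral>\<^sup>+x. \<integral>\<^sup>+y. ennreal (h x * k y * w x y) \<partial>unit_lebesgue \<partial>unit_lebesgue)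
    = ennreal (\<integral>x. h x * T k x \<partial>unit_lebesgue)"
proof -
  have "(\<integral>\<^sup>+x. \<integral>\<^sup>+y. ennreal (h x * k y * w x y) \<partial>unit_lebesgue \<partial>unit_lebesgue)
    = (\<integral>\<^sup>+x. ennreal (h x * T k x) \<partial>unit_lebesgue)"
  proof (rule nn_integral_cong)
    fix x assume x: "x \<in> space unit_lebesgue"
    have [measurable]: "(\<lambda>y. w x y) \<in> borel_measurable unit_lebesgue"
      using x by measurable
    have "(\<integral>\<^sup>+y. ennreal (h x * k y * w x y) \<partial>unit_lebesgue) = ennreal (\<integral>y. h x * k y * w x y \<partial>unit_lebesgue)"
      using h k kernel_nonneg kernel_le_1
      by (intro nn_integral_eq_integral unit.integrable_unit_bounded) (auto intro!: mult_le_one)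
    also have "(\<integral>y. h x * k y * w x y \<partial>unit_lebesgue) = (\<integral>y. h x * (w x y * k y) \<partial>unit_lebesgue)"
      by (simp add: ac_simps)
    also have "\<dots> = h x * T k x"
      unfolding T_def by (rule integral_mult_right_zero)
    finally show "(\<integral>\<^sup>+y. ennreal (h x * k y * w x y) \<partial>unit_lebesgue) = ennreal (h x * T k x)" .
  qed
  also have "\<dots> = ennreal (\<integral>x. h x * T k x \<partial>unit_lebesgue)"
    using h k T_nonneg T_le_1
    by (intro nn_integral_eq_integral unit.integrable_unit_bounded) (auto intro!: mult_le_one)
  finally show ?thesis .
qed

lemma nn_integral_kernel_swap:
  assumes [measurable]: "h \<in> borel_measurable unit_lebesgue" "k \<in> borel_measurable unit_lebesgue"
  shows "(\<integral>\<^sup>+x. \<integral>\<^sup>+y. ennreal (h x * k y * w x y) \<partial>unit_lebesgue \<partial>unit_lebesgue)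
    = (\<integral>\<^sup>+x. \<integral>\<^sup>+y. ennreal (k x * h y * w x y) \<partial>unit_lebesgue \<partial>unit_lebesgue)"
proof -
  have "(\<integral>\<^sup>+x. \<integral>\<^sup>+y. ennreal (h x * k y * w x y) \<partial>unit_lebesgue \<partial>unit_lebesgue)
    = (\<integral>\<^sup>+y. \<integral>\<^sup>+x. ennreal (h x * k y * w x y) \<partial>unit_lebesgue \<partial>unit_lebesgue)"
    by (rule unit2.Fubini'[symmetric]) measurable
  also have "\<dots> = (\<integral>\<^sup>+x. \<integral>\<^sup>+y. ennreal (k x * h y * w x y) \<partial>unit_lebesgue \<partial>unit_lebesgue)"
    by (simp add: ac_simps kernel_sym)
  finally show ?thesis .
qed

text \<open>
  If \<open>g n\<close> converges weakly, then \<open>T (g n)\<close> converges strongly to some \<open>u\<close>, and the energies \<open>\<integral> g n \<cdot> T (g n)\<close>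
  tend to \<open>\<integral> g n \<cdot> u\<close>. Restricting \<open>g n\<close> to the zero set of \<open>u\<close> makes also the mixed energies
  tend to \<open>0\<close>; along a sparse subsequence they are summable, which forces the support of the limes
  superior to be independent.
\<close>

lemma independent_set_of_weak_limit:
  fixes g :: "nat \<Rightarrow> real \<Rightarrow> real"
  assumes g_meas [measurable]: "\<And>n. g n \<in> borel_measurable unit_lebesgue"
    and g: "\<And>n x. 0 \<le> g n x" "\<And>n x. g n x \<le> 1"
    and weak: "\<And>\<phi>. \<phi> \<in> borel_measurable unit_lebesgue \<Longrightarrow> (\<And>x. 0 \<le> \<phi> x) \<Longrightarrow> (\<And>x. \<phi> x \<le> 1) \<Longrightarrow>
      convergent (\<lambda>n. \<integral>x. \<phi> x * g n x \<partial>unit_lebesgue)"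
    and energy0: "(\<lambda>n. \<integral>x. g n x * T (g n) x \<partial>unit_lebesgue) \<longlonglongrightarrow> 0"
    and b: "\<And>n. b \<le> (\<integral>\<^sup>+x. g n x \<partial>unit_lebesgue)"
  shows "\<exists>S\<in>sets unit_lebesgue. b \<le> emeasure unit_lebesgue S \<and>
    (AE x in unit_lebesgue. AE y in unit_lebesgue. x \<in> S \<longrightarrow> y \<in> S \<longrightarrow> w x y = 0)"
proof -
  define t where "t = (\<lambda>n. T (g n))"
  have Tg: "T (g n) = t n" for n
    by (simp add: t_def)
  have t_meas [measurable]: "t n \<in> borel_measurable unit_lebesgue" for n
    unfolding t_def by measurable
  have t: "0 \<le> t n x" "t n x \<le> 1" for n x
    by (auto simp: t_def intro: T_nonneg T_le_1 g)
  \<comment> \<open>The clipping keeps \<open>u\<close> in \<open>[0, 1]\<close> also outside the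
    unit interval, where \<open>lim\<close> may be arbitrary.\<close>
  define u where "u = (\<lambda>x. max 0 (min 1 (lim (\<lambda>n. t n x))))"
  have u_meas [measurable]: "u \<in> borel_measurable unit_lebesgue"
    unfolding u_def by measurable
  have u: "0 \<le> u x" "u x \<le> 1" for x
    by (auto simp: u_def)
  have t_lim: "(\<lambda>n. t n x) \<longlonglongrightarrow> u x" if "x \<in> space unit_lebesgue" for x
  proof -
    \<comment> \<open>The section of the kernel at a fixed \<open>x\<close> is itself a test
      function, so weak convergence of \<open>g n\<close> gives pointwise convergence of
      \<open>t n\<close>. This is where compactness of the operator enters.\<close>
    have "(\<lambda>y. w x y) \<in> borel_measurable unit_lebesgue"
      using that by measurable
    then have "convergent (\<lambda>n. t n x)"
      unfolding t_def T_def by (rule weak) (auto intro: kernel_nonneg kernel_le_1)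
    then have lim: "(\<lambda>n. t n x) \<longlonglongrightarrow> lim (\<lambda>n. t n x)"
      by (simp add: convergent_LIMSEQ_iff)
    then have "0 \<le> lim (\<lambda>n. t n x)" "lim (\<lambda>n. t n x) \<le> 1"
      using t by (auto intro: LIMSEQ_le_const LIMSEQ_le_const2)
    then show ?thesis
      using lim by (simp add: u_def)
  qed
  have int: "integrable unit_lebesgue (\<lambda>x. h x * k x)"
    if "h \<in> borel_measurable unit_lebesgue" "k \<in> borel_measurable unit_lebesgue"
      "\<And>x. 0 \<le> h x" "\<And>x. h x \<le> 1" "\<And>x. 0 \<le> k x" "\<And>x. k x \<le> 1" for h k :: "real \<Rightarrow> real"
  proof (rule unit.integrable_unit_bounded)
    show "(\<lambda>x. h x * k x) \<in> borel_measurable unit_lebesgue"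
      using that(1,2) by measurable
  qed (use that(3-) in \<open>auto intro!: mult_le_one\<close>)
  have tu: "\<bar>t n x - u x\<bar> \<le> 1" for n x
    using t[of n x] u[of x] by auto
  have "(\<lambda>n. \<integral>x. \<bar>t n x - u x\<bar> \<partial>unit_lebesgue) \<longlonglongrightarrow> (\<integral>x. 0 \<partial>unit_lebesgue)"
  proof (intro integral_dominated_convergence[where w="\<lambda>_. 1"] AE_I2)
    fix x assume "x \<in> space unit_lebesgue"
    from t_lim[OF this] show "(\<lambda>n. \<bar>t n x - u x\<bar>) \<longlonglongrightarrow> 0"
      by (intro tendsto_rabs_zero) (simp add: LIM_zero)
  qed (use tu in auto)
  then have tu0: "(\<lambda>n. \<integral>x. \<bar>t n x - u x\<bar> \<partial>unit_lebesgue) \<longlonglongrightarrow> 0"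
    by simp
  \<comment> \<open>As \<open>g n \<le> 1\<close>, the integral exceeds the energy of
    \<open>g n\<close> by at most the \<open>L^1\<close> distance of \<open>t n\<close> and
    \<open>u\<close>; both tend to 0.\<close>
  have gu0: "(\<lambda>n. \<integral>x. g n x * u x \<partial>unit_lebesgue) \<longlonglongrightarrow> 0"
  proof (rule tendsto_sandwich[OF _ _ tendsto_const tendsto_add_zero[OF energy0 tu0]])
    have "(\<integral>x. g n x * u x \<partial>unit_lebesgue)
        \<le> (\<integral>x. g n x * t n x + \<bar>t n x - u x\<bar> \<partial>unit_lebesgue)" for n
    proof (rule integral_mono')
      show "integrable unit_lebesgue (\<lambda>x. g n x * t n x + \<bar>t n x - u x\<bar>)"
        using tu by (intro Bochner_Integration.integrable_add unit.integrable_unit_bounded int g t) auto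
      fix x
      show "0 \<le> g n x * t n x + \<bar>t n x - u x\<bar>"
        using g t by simp
      have "g n x * (u x - t n x) \<le> g n x * \<bar>t n x - u x\<bar>"
        using g by (intro mult_left_mono) auto
      also have "\<dots> \<le> 1 * \<bar>t n x - u x\<bar>"
        using g by (intro mult_right_mono) auto
      finally show "g n x * u x \<le> g n x * t n x + \<bar>t n x - u x\<bar>"
        by (simp add: algebra_simps)
    qed
    also have "(\<integral>x. g n x * t n x + \<bar>t n x - u x\<bar> \<partial>unit_lebesgue)
      = (\<integral>x. g n x * T (g n) x \<partial>unit_lebesgue) + (\<integral>x. \<bar>t n x - u x\<bar> \<partial>unit_lebesgue)" for n
      unfolding Tg using tu
      by (intro Bochner_Integration.integral_add unit.integrable_unit_bounded int g t) auto
    finally show "\<forall>\<^sub>F n in sequentially. (\<integral>x. g n x * u x \<partial>unit_lebesgue)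
      \<le> (\<integral>x. g n x * T (g n) x \<partial>unit_lebesgue) + (\<integral>x. \<bar>t n x - u x\<bar> \<partial>unit_lebesgue)"
      by simp
    show "\<forall>\<^sub>F n in sequentially. 0 \<le> (\<integral>x. g n x * u x \<partial>unit_lebesgue)"
      using g u by (intro always_eventually allI integral_nonneg_AE AE_I2 mult_nonneg_nonneg)
  qed
  define G where "G = (\<lambda>n x. if u x = 0 then g n x else 0)"
  have G_meas [measurable]: "G n \<in> borel_measurable unit_lebesgue" for n
    unfolding G_def by measurable
  have G: "0 \<le> G n x" "G n x \<le> 1" "G n x \<le> g n x" for n x
    using g by (auto simp: G_def)
  have cross: "(\<lambda>n. \<integral>x. G i x * t n x \<partial>unit_lebesgue) \<longlonglongrightarrow> 0" for i
  proof -
    have "(\<lambda>n. \<integral>x. G i x * t n x \<partial>unit_lebesgue) \<longlonglongrightarrow> (\<integral>x. G i x * u x \<partial>unit_lebesgue)"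
    proof (intro integral_dominated_convergence[where w="\<lambda>_. 1"] AE_I2)
      fix x assume "x \<in> space unit_lebesgue"
      from t_lim[OF this] show "(\<lambda>n. G i x * t n x) \<longlonglongrightarrow> G i x * u x"
        by (intro tendsto_intros)
    qed (use G t in \<open>auto simp: abs_mult intro: mult_le_one\<close>)
    moreover have "(\<lambda>x. G i x * u x) = (\<lambda>x. 0)"
      by (auto simp: G_def)
    ultimately show ?thesis by simp
  qed
  \<comment> \<open>The two vanishing sequences enter as one sum; both being nonnegative, either one
    is below \<open>(1/4) ^ j\<close>. For \<open>i \<le> j\<close> this is at most
    \<open>(1/2) ^ i * (1/2) ^ j\<close>, which is symmetric and summable over both indices.\<close>
  obtain r :: "nat \<Rightarrow> nat" where r: "strict_mono r"
    and r1: "\<And>j. (\<integral>x. g (r j) x * T (g (r j)) x \<partial>unit_lebesgue) + (\<integral>x. g (r j) x * u x \<partial>unit_lebesgue) \<le> (1/4) ^ j"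
    and r2: "\<And>i j. i < j \<Longrightarrow> (\<integral>x. G (r i) x * t (r j) x \<partial>unit_lebesgue) \<le> (1/4) ^ j"
    by (rule double_seq_subseq[of "\<lambda>i n. \<integral>x. G i x * t n x \<partial>unit_lebesgue", OF cross tendsto_add_zero[OF energy0 gu0]])
      (rule that; assumption)
  define A where "A = (\<lambda>i j. \<integral>\<^sup>+x. \<integral>\<^sup>+y. ennreal (G (r i) x * G (r j) y * w x y) \<partial>unit_lebesgue \<partial>unit_lebesgue)"
  \<comment> \<open>Only the second function is enlarged back to \<open>g\<close>: the first keeps
    its restriction to the zero set of \<open>u\<close>, on which \<open>cross\<close>
    relies.\<close>
  have A_le: "A i j \<le> ennreal (\<integral>x. G (r i) x * t (r j) x \<partial>unit_lebesgue)" for i j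
  proof -
    have "A i j \<le> (\<integral>\<^sup>+x. \<integral>\<^sup>+y. ennreal (G (r i) x * g (r j) y * w x y) \<partial>unit_lebesgue \<partial>unit_lebesgue)"
      unfolding A_def using G g kernel_nonneg
      by (intro nn_integral_mono ennreal_leI mult_right_mono mult_left_mono)
    also have "\<dots> = ennreal (\<integral>x. G (r i) x * t (r j) x \<partial>unit_lebesgue)"
      unfolding t_def using G g by (intro nn_integral_kernel) auto
    finally show ?thesis .
  qed
  have A_sym: "A i j = A j i" for i j
    unfolding A_def by (rule nn_integral_kernel_swap) measurable
  have nonneg1: "0 \<le> (\<integral>x. g n x * T (g n) x \<partial>unit_lebesgue)" for n
    using g by (intro integral_nonneg_AE AE_I2 mult_nonneg_nonneg T_nonneg)
  have nonneg2: "0 \<le> (\<integral>x. g n x * u x \<partial>unit_lebesgue)" for n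
    using g u by (intro integral_nonneg_AE AE_I2 mult_nonneg_nonneg)
  have A_bound_le: "A i j \<le> ennreal ((1/2) ^ i * (1/2) ^ j)" if "i \<le> j" for i j
  proof -
    have "(\<integral>x. G (r i) x * t (r j) x \<partial>unit_lebesgue) \<le> (1/4) ^ j"
    proof (cases "i = j")
      case True
      have "(\<integral>x. G (r i) x * t (r j) x \<partial>unit_lebesgue) \<le> (\<integral>x. g (r j) x * T (g (r j)) x \<partial>unit_lebesgue)"
        unfolding True Tg using G g t
        by (intro integral_mono' int) (auto intro: mult_right_mono)
      then show ?thesis
        using r1[of j] nonneg2[of "r j"] by linarith
    qed (use r2 that in simp)
    also have "(1/4) ^ j = (1/2) ^ j * (1/2::real) ^ j"
      by (simp add: power_mult_distrib[symmetric])
    also have "\<dots> \<le> (1/2) ^ i * (1/2) ^ j"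
      using that by (intro mult_right_mono power_decreasing) auto
    finally show ?thesis
      using A_le[of i j] by (meson ennreal_leI order_trans)
  qed
  have A_bound: "A i j \<le> ennreal ((1/2) ^ i) * ennreal ((1/2) ^ j)" for i j
  proof -
    have "A i j \<le> ennreal ((1/2) ^ i * (1/2) ^ j)"
    proof (cases "i \<le> j")
      case False
      then show ?thesis
        using A_bound_le[of j i] unfolding A_sym[of i j] mult.commute[of "(1/2) ^ i"] by simp
    qed (rule A_bound_le)
    then show ?thesis
      by (simp add: ennreal_mult)
  qed
  have half: "(\<Sum>i. ennreal ((1/2) ^ i)) = ennreal 2"
  proof (rule suminf_ennreal_eq)
    show "(\<lambda>i. (1/2::real) ^ i) sums 2"
      using geometric_sums[of "1/2::real"] by simp
  qed simp
  have "(\<Sum>i. \<Sum>j. A i j) \<le> (\<Sum>i. \<Sum>j. ennreal ((1/2) ^ i) * ennreal ((1/2) ^ j))"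
    by (intro suminf_le A_bound summableI)
  also have "\<dots> = ennreal 2 * ennreal 2"
    by (simp only: ennreal_suminf_cmult ennreal_suminf_multc half)
  finally have A_sum: "(\<Sum>i. \<Sum>j. A i j) \<noteq> \<top>"
    by (auto simp: top_unique)
  \<comment> \<open>Summing all mixed energies gives the energy of \<open>H\<close>, which is
    finite. So \<open>w\<close> vanishes at almost all pairs of points where \<open>H\<close> is
    infinite, and the set \<open>S\<close> below consists of such points.\<close>
  define H where "H = (\<lambda>x. \<Sum>j. ennreal (G (r j) x))"
  have H_meas [measurable]: "H \<in> borel_measurable unit_lebesgue"
    unfolding H_def by measurable
  have "(\<integral>\<^sup>+x. \<integral>\<^sup>+y. H x * H y * ennreal (w x y) \<partial>unit_lebesgue \<partial>unit_lebesgue) = (\<Sum>i. \<Sum>j. A i j)"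
  proof -
    have "H x * H y * ennreal (w x y) = (\<Sum>i. \<Sum>j. ennreal (G (r i) x * G (r j) y * w x y))" for x y
      unfolding H_def by (simp add: ennreal_mult G kernel_nonneg)
    then have "(\<integral>\<^sup>+x. \<integral>\<^sup>+y. H x * H y * ennreal (w x y) \<partial>unit_lebesgue \<partial>unit_lebesgue)
      = (\<integral>\<^sup>+x. \<integral>\<^sup>+y. (\<Sum>i. \<Sum>j. ennreal (G (r i) x * G (r j) y * w x y)) \<partial>unit_lebesgue \<partial>unit_lebesgue)"
      by simp
    also have "\<dots> = (\<integral>\<^sup>+x. (\<Sum>i. \<Sum>j. \<integral>\<^sup>+y. ennreal (G (r i) x * G (r j) y * w x y) \<partial>unit_lebesgue) \<partial>unit_lebesgue)"
    proof (rule nn_integral_cong)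
      fix x assume x: "x \<in> space unit_lebesgue"
      have [measurable]: "(\<lambda>y. w x y) \<in> borel_measurable unit_lebesgue"
        using x by measurable
      show "(\<integral>\<^sup>+y. (\<Sum>i. \<Sum>j. ennreal (G (r i) x * G (r j) y * w x y)) \<partial>unit_lebesgue)
        = (\<Sum>i. \<Sum>j. \<integral>\<^sup>+y. ennreal (G (r i) x * G (r j) y * w x y) \<partial>unit_lebesgue)"
        by (subst nn_integral_suminf, measurable, subst nn_integral_suminf, measurable)
    qed
    also have "\<dots> = (\<Sum>i. \<Sum>j. A i j)"
      unfolding A_def by (subst nn_integral_suminf, measurable, subst nn_integral_suminf, measurable)
    finally show ?thesis .
  qed
  then have "(\<integral>\<^sup>+x. \<integral>\<^sup>+y. H x * H y * ennreal (w x y) \<partial>unit_lebesgue \<partial>unit_lebesgue) \<noteq> \<top>"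
    using A_sum by simp
  then have "AE x in unit_lebesgue. (\<integral>\<^sup>+y. H x * H y * ennreal (w x y) \<partial>unit_lebesgue) \<noteq> \<infinity>"
    by (intro nn_integral_noteq_infinite) auto
  then have "AE x in unit_lebesgue. AE y in unit_lebesgue. H x * H y * ennreal (w x y) \<noteq> \<infinity>"
    using AE_space
  proof eventually_elim
    fix x assume x: "x \<in> space unit_lebesgue"
      and fin: "(\<integral>\<^sup>+y. H x * H y * ennreal (w x y) \<partial>unit_lebesgue) \<noteq> \<infinity>"
    have [measurable]: "(\<lambda>y. w x y) \<in> borel_measurable unit_lebesgue"
      using x by measurable
    show "AE y in unit_lebesgue. H x * H y * ennreal (w x y) \<noteq> \<infinity>"
      by (rule nn_integral_noteq_infinite[OF _ fin]) measurable
  qed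
  moreover define S where "S = {x \<in> space unit_lebesgue. 0 < limsup (\<lambda>j. ennreal (G (r j) x))}"
  moreover have H_inf: "H x = \<infinity>" if "x \<in> S" for x
    using that limsup_eq_0_if_suminf_finite[of "\<lambda>j. ennreal (G (r j) x)"]
    unfolding S_def H_def infinity_ennreal_def mem_Collect_eq by (metis less_irrefl)
  ultimately have indep: "AE x in unit_lebesgue. AE y in unit_lebesgue. x \<in> S \<longrightarrow> y \<in> S \<longrightarrow> w x y = 0"
  proof (elim eventually_mono, intro impI)
    fix x y
    assume "H x * H y * ennreal (w x y) \<noteq> \<infinity>" "x \<in> S" "y \<in> S"
    then have "\<not> 0 < w x y"
      by (auto simp: H_inf ennreal_top_mult)
    then show "w x y = 0"
      using kernel_nonneg[of x y] by linarith
  qed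
  have S_sets: "S \<in> sets unit_lebesgue"
    unfolding S_def by measurable
  \<comment> \<open>The integrals of \<open>g (r j) * u\<close> are summable, so
    \<open>g (r j) x\<close> tends to 0 at almost every \<open>x\<close> with
    \<open>u x \<noteq> 0\<close>. Passing from \<open>g\<close> to \<open>G\<close> thus loses
    nothing in the limes superior.\<close>
  have "(\<integral>\<^sup>+x. (\<Sum>j. ennreal (g (r j) x * u x)) \<partial>unit_lebesgue) = (\<Sum>j. \<integral>\<^sup>+x. ennreal (g (r j) x * u x) \<partial>unit_lebesgue)"
    by (rule nn_integral_suminf) measurable
  also have "\<dots> = (\<Sum>j. ennreal (\<integral>x. g (r j) x * u x \<partial>unit_lebesgue))"
    using g u by (intro suminf_cong nn_integral_eq_integral int) auto
  also have "\<dots> \<le> (\<Sum>j. ennreal ((1/2) ^ j))"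
  proof (intro suminf_le summableI ennreal_leI)
    fix j
    have "(\<integral>x. g (r j) x * u x \<partial>unit_lebesgue) \<le> (1/4) ^ j"
      using r1[of j] nonneg1[of "r j"] by linarith
    also have "\<dots> \<le> (1/2) ^ j"
      by (rule power_mono) auto
    finally show "(\<integral>x. g (r j) x * u x \<partial>unit_lebesgue) \<le> (1/2) ^ j" .
  qed
  finally have "(\<integral>\<^sup>+x. (\<Sum>j. ennreal (g (r j) x * u x)) \<partial>unit_lebesgue) \<noteq> \<infinity>"
    unfolding half by (auto simp: top_unique)
  then have ae_u: "AE x in unit_lebesgue. (\<Sum>j. ennreal (g (r j) x * u x)) \<noteq> \<infinity>"
    by (intro nn_integral_noteq_infinite) auto
  have ae_limsup: "AE x in unit_lebesgue. limsup (\<lambda>j. ennreal (g (r j) x)) \<le> indicator S x"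
    using ae_u
  proof (rule AE_mp, intro AE_I2 impI)
    fix x assume x: "x \<in> space unit_lebesgue" and fin: "(\<Sum>j. ennreal (g (r j) x * u x)) \<noteq> \<infinity>"
    have "limsup (\<lambda>j. ennreal (g (r j) x)) \<le> limsup (\<lambda>j. 1::ennreal)"
      using g by (intro Limsup_mono always_eventually) (auto simp: ennreal_le_1)
    then have le1: "limsup (\<lambda>j. ennreal (g (r j) x)) \<le> 1"
      by (simp add: Limsup_const)
    show "limsup (\<lambda>j. ennreal (g (r j) x)) \<le> indicator S x"
    proof (cases "u x = 0")
      case True
      then have "G (r j) x = g (r j) x" for j
        by (simp add: G_def)
      then show ?thesis
        using le1 x by (auto simp: S_def indicator_def)
    next
      case False
      have "(\<Sum>j. ennreal (g (r j) x)) * ennreal (u x) \<noteq> \<top>"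
        using fin g u by (simp add: ennreal_mult)
      then have "(\<Sum>j. ennreal (g (r j) x)) \<noteq> \<top>"
        using False u[of x] by (auto simp: ennreal_mult_eq_top_iff ennreal_eq_0_iff)
      then show ?thesis
        by (simp add: limsup_eq_0_if_suminf_finite)
    qed
  qed
  \<comment> \<open>Reverse Fatou with dominating function 1; almost everywhere the limes superior
    is at most the indicator of \<open>S\<close>.\<close>
  have "b \<le> limsup (\<lambda>j. \<integral>\<^sup>+x. ennreal (g (r j) x) \<partial>unit_lebesgue)"
    by (intro le_Limsup always_eventually allI b) simp
  also have "\<dots> \<le> (\<integral>\<^sup>+x. limsup (\<lambda>j. ennreal (g (r j) x)) \<partial>unit_lebesgue)"
    using g by (intro nn_integral_limsup[where w="\<lambda>_. 1"]) (auto simp: ennreal_le_1 unit.emeasure_space_1[simplified])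
  also have "\<dots> \<le> (\<integral>\<^sup>+x. indicator S x \<partial>unit_lebesgue)"
    using ae_limsup by (rule nn_integral_mono_AE)
  also have "\<dots> = emeasure unit_lebesgue S"
    using S_sets by simp
  finally show ?thesis
    using S_sets indep by blast
qed

lemma independent_set_of_vanishing_energy:
  fixes g :: "nat \<Rightarrow> real \<Rightarrow> real"
  assumes g_meas [measurable]: "\<And>n. g n \<in> borel_measurable unit_lebesgue"
    and g: "\<And>n x. 0 \<le> g n x" "\<And>n x. g n x \<le> 1"
    and energy0: "(\<lambda>n. \<integral>\<^sup>+x. \<integral>\<^sup>+y. ennreal (g n x * g n y * w x y) \<partial>unit_lebesgue \<partial>unit_lebesgue) \<longlonglongrightarrow> 0"
    and b: "\<And>n. b \<le> (\<integral>\<^sup>+x. g n x \<partial>unit_lebesgue)"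
  shows "\<exists>S\<in>sets unit_lebesgue. b \<le> emeasure unit_lebesgue S \<and>
    (AE x in unit_lebesgue. AE y in unit_lebesgue. x \<in> S \<longrightarrow> y \<in> S \<longrightarrow> w x y = 0)"
proof (rule weakly_convergent_subseq[of g, OF g_meas g])
  fix r :: "nat \<Rightarrow> nat"
  assume r: "strict_mono r" and
    weak: "\<And>\<phi>. \<phi> \<in> borel_measurable unit_lebesgue \<Longrightarrow> (\<And>x. 0 \<le> \<phi> x) \<Longrightarrow> (\<And>x. \<phi> x \<le> 1) \<Longrightarrow>
      convergent (\<lambda>n. \<integral>x. \<phi> x * g (r n) x \<partial>unit_lebesgue)"
  have "(\<lambda>n. ennreal (\<integral>x. g n x * T (g n) x \<partial>unit_lebesgue)) \<longlonglongrightarrow> ennreal 0"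
    using energy0 g by (simp add: nn_integral_kernel)
  then have "(\<lambda>n. \<integral>x. g n x * T (g n) x \<partial>unit_lebesgue) \<longlonglongrightarrow> 0"
    using g by (subst (asm) tendsto_ennreal_iff)
      (auto intro!: always_eventually integral_nonneg_AE AE_I2 mult_nonneg_nonneg T_nonneg)
  from LIMSEQ_subseq_LIMSEQ[OF this r]
  have "(\<lambda>n. \<integral>x. g (r n) x * T (g (r n)) x \<partial>unit_lebesgue) \<longlonglongrightarrow> 0"
    by (simp add: o_def)
  then show ?thesis
    by (intro independent_set_of_weak_limit[of "\<lambda>n. g (r n)"] weak g b) auto
qed

end

section \<open>Sampling from a graphon\<close>

text \<open>It suffices to compare both measures on rectangles, where distinct coordinates are
  independent. The lemma carries null sets of the square over to the sampled points.\<close>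

lemma (in prob_space) distr_PiM_pair:
  assumes "finite I" "i \<in> I" "j \<in> I" "i \<noteq> j"
  shows "distr (Pi\<^sub>M I (\<lambda>_. M)) (M \<Otimes>\<^sub>M M) (\<lambda>x. (x i, x j)) = M \<Otimes>\<^sub>M M"
proof (rule pair_measure_eqI[symmetric])
  interpret P: product_prob_space "\<lambda>_. M" I
    by unfold_locales
  fix A B assume AB [measurable]: "A \<in> sets M" "B \<in> sets M"
  have [measurable]: "(\<lambda>x. x i) \<in> Pi\<^sub>M I (\<lambda>_. M) \<rightarrow>\<^sub>M M" "(\<lambda>x. x j) \<in> Pi\<^sub>M I (\<lambda>_. M) \<rightarrow>\<^sub>M M"
    using assms by measurable
  have "emeasure (distr (Pi\<^sub>M I (\<lambda>_. M)) (M \<Otimes>\<^sub>M M) (\<lambda>x. (x i, x j))) (A \<times> B)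
    = emeasure (Pi\<^sub>M I (\<lambda>_. M)) {x \<in> space (Pi\<^sub>M I (\<lambda>_. M)). \<forall>l\<in>{i, j}. x l \<in> (if l = i then A else B)}"
    using assms by (subst emeasure_distr) (auto intro!: arg_cong2[where f=emeasure])
  also have "\<dots> = (\<Prod>l\<in>{i, j}. emeasure M (if l = i then A else B))"
    using assms AB by (intro P.emeasure_PiM_Collect) auto
  also have "\<dots> = emeasure M A * emeasure M B"
    using assms by simp
  finally show "emeasure M A * emeasure M B = emeasure (distr (Pi\<^sub>M I (\<lambda>_. M)) (M \<Otimes>\<^sub>M M) (\<lambda>x. (x i, x j))) (A \<times> B)" ..
qed (simp_all add: sigma_finite_measure_axioms)

section \<open>Null sets, completions and Borel representatives\<close>

lemma AE_unit_lebesgue_iff: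
  "(AE x in unit_lebesgue. P x) \<longleftrightarrow> (AE x in lborel. x \<in> {0..1} \<longrightarrow> P x)"
  by (simp add: AE_restrict_space_iff AE_completion_iff)

lemma unit_pair_measurable_of_borel:
  assumes "f \<in> borel \<Otimes>\<^sub>M borel \<rightarrow>\<^sub>M N"
  shows "f \<in> unit_lebesgue \<Otimes>\<^sub>M unit_lebesgue \<rightarrow>\<^sub>M N"
proof (rule measurable_compose[OF _ assms])
  have [measurable]: "(\<lambda>x::real. x) \<in> unit_lebesgue \<rightarrow>\<^sub>M borel"
    by (intro measurable_restrict_space1 measurable_completion) simp
  have "(\<lambda>p. (fst p, snd p)) \<in> unit_lebesgue \<Otimes>\<^sub>M unit_lebesgue \<rightarrow>\<^sub>M borel \<Otimes>\<^sub>M borel"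
    by measurable
  then show "(\<lambda>p. p) \<in> unit_lebesgue \<Otimes>\<^sub>M unit_lebesgue \<rightarrow>\<^sub>M (borel \<Otimes>\<^sub>M borel :: (real \<times> real) measure)"
    by simp
qed

text \<open>The set where \<open>P\<close> fails need not be measurable for the product of the two
  measures. It is covered by a Borel null set, which is sliced by Fubini and reassembled.\<close>

lemma AE_unit_pair:
  assumes "AE p in (lborel :: (real \<times> real) measure). p \<in> {0..1} \<times> {0..1} \<longrightarrow> P p"
  shows "AE p in unit_lebesgue \<Otimes>\<^sub>M unit_lebesgue. P p"
proof -
  obtain N where N: "N \<in> null_sets (lborel :: (real \<times> real) measure)"
    "{p. \<not> (p \<in> {0..1} \<times> {0..1} \<longrightarrow> P p)} \<subseteq> N"
    using assms unfolding eventually_ae_filter by auto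
  then have "AE p in lborel \<Otimes>\<^sub>M lborel. p \<notin> N"
    unfolding lborel_prod by (intro AE_not_in)
  then have "AE x in lborel. AE y in lborel. (x, y) \<notin> N"
    by (rule lborel_pair.AE_pair)
  then have "AE x in unit_lebesgue. AE y in unit_lebesgue. (x, y) \<notin> N"
    unfolding AE_unit_lebesgue_iff by (auto elim!: eventually_mono)
  moreover have "Measurable.pred (borel \<Otimes>\<^sub>M borel) (\<lambda>p. p \<notin> N)"
    using N(1) by (auto simp: borel_prod null_sets_def pred_def Collect_neg_eq)
  then have "Measurable.pred (unit_lebesgue \<Otimes>\<^sub>M unit_lebesgue) (\<lambda>p. p \<notin> N)"
    by (rule unit_pair_measurable_of_borel)
  ultimately have "AE p in unit_lebesgue \<Otimes>\<^sub>M unit_lebesgue. p \<notin> N"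
    by (intro unit2.AE_pair_measure) (auto simp: pred_def)
  then show ?thesis
    using AE_space by eventually_elim (use N(2) in \<open>auto simp: space_pair_measure\<close>)
qed

lemma borel_sandwich:
  fixes S :: "'a::euclidean_space set"
  assumes "S \<in> sets lebesgue"
  obtains B C where "B \<in> sets borel" "C \<in> sets borel" "B \<subseteq> S" "S \<subseteq> C"
    "emeasure lborel B = emeasure lebesgue S" "emeasure lborel C = emeasure lebesgue S"
proof -
  obtain B N N' where S: "S = B \<union> N" "N \<subseteq> N'" "N' \<in> null_sets lborel" "B \<in> sets lborel"
    using assms by (rule sets_completionE)
  have "emeasure lborel (B \<union> N') = emeasure lborel B"
    using S by (intro emeasure_Un_null_set) auto
  moreover have "emeasure lebesgue S \<le> emeasure lebesgue (B \<union> N')"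
    using S by (intro emeasure_mono) (auto simp: null_sets_def)
  moreover have "emeasure lebesgue B \<le> emeasure lebesgue S"
    using S assms by (intro emeasure_mono) auto
  ultimately show thesis
    using S by (intro that[of B "B \<union> N'"]) (auto simp: null_sets_def)
qed

text \<open>The squares of Borel sets \<open>B \<subseteq> S \<subseteq> C\<close> of equal measure
  enclose \<open>S \<times> S\<close> and have equal measure, finite because \<open>S\<close> lies
  in the unit interval; completeness does the rest.\<close>

lemma lebesgue_Times:
  fixes S :: "real set"
  assumes "S \<in> sets lebesgue" "S \<subseteq> {0..1}"
  shows "S \<times> S \<in> sets lebesgue"
proof -
  obtain B C where BC: "B \<in> sets borel" "C \<in> sets borel" "B \<subseteq> S" "S \<subseteq> C"
    "emeasure lborel B = emeasure lebesgue S" "emeasure lborel C = emeasure lebesgue S"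
    using assms(1) by (rule borel_sandwich)
  have em: "emeasure lborel (X \<times> X) = emeasure lborel X * emeasure lborel X"
    and sets: "X \<times> X \<in> sets lborel" if "X \<in> sets borel" for X :: "real set"
  proof -
    have "X \<times> X \<in> sets (borel \<Otimes>\<^sub>M borel :: (real \<times> real) measure)"
      using that by (rule pair_measureI) (rule that)
    then show sets: "X \<times> X \<in> sets lborel"
      unfolding borel_prod sets_lborel .
    have "emeasure lborel (X \<times> X) = emeasure (lborel \<Otimes>\<^sub>M lborel) (X \<times> X)"
      by (simp add: lborel_prod)
    then show "emeasure lborel (X \<times> X) = emeasure lborel X * emeasure lborel X"
      using that by (simp add: lborel.emeasure_pair_measure_Times)
  qed
  have "emeasure lebesgue S \<le> emeasure lebesgue {0..1::real}"
    using assms by (intro emeasure_mono) auto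
  then have "emeasure lebesgue S < \<infinity>"
    by (auto simp: less_top[symmetric] top_unique)
  then show ?thesis
    using BC sets by (intro completion.complete_sets_sandwich[of "B \<times> B" lborel "C \<times> C" "S \<times> S"])
      (auto simp: em ennreal_mult_less_top)
qed

lemma measurable_completion_AE:
  fixes f g :: "'a \<Rightarrow> 'b::topological_space"
  assumes g [measurable]: "g \<in> borel_measurable M" and ae: "AE x in M. f x = g x"
  shows "f \<in> borel_measurable (completion M)"
proof (rule measurableI)
  fix A :: "'b set" assume A: "A \<in> sets borel"
  show "f -` A \<inter> space (completion M) \<in> sets (completion M)"
  proof (rule completion.in_sets_AE)
    show "g -` A \<inter> space M \<in> sets (completion M)"
      using measurable_sets[OF g A] by simp
    show "AE x in completion M. x \<in> g -` A \<inter> space M \<longleftrightarrow> x \<in> f -` A \<inter> space (completion M)"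
      using AE_completion[OF ae] by eventually_elim auto
  qed auto
qed simp

text \<open>A Borel function almost everywhere equal to \<open>W\<close> need not be symmetric or
  bounded. Averaging it with its transpose and clipping restores both at every point, and still
  gives \<open>W\<close> almost everywhere on the square.\<close>

lemma graphon_borel_representative:
  assumes "graphon W"
  obtains w :: "real \<Rightarrow> real \<Rightarrow> real" where "(\<lambda>(x, y). w x y) \<in> borel_measurable (borel \<Otimes>\<^sub>M borel)"
    "\<And>x y. 0 \<le> w x y" "\<And>x y. w x y \<le> 1" "\<And>x y. w x y = w y x"
    "AE (x, y) in lborel. (x, y) \<in> {0..1} \<times> {0..1} \<longrightarrow> W x y = w x y"
proof -
  let ?Q = "{0..1} \<times> {0..1} :: (real \<times> real) set"
  have Wm: "(\<lambda>(x, y). W x y) \<in> borel_measurable (lebesgue_on ?Q)"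
    and Ws: "\<And>x y. (x, y) \<in> ?Q \<Longrightarrow> W x y = W y x"
    and W01: "\<And>x y. (x, y) \<in> ?Q \<Longrightarrow> 0 \<le> W x y \<and> W x y \<le> 1"
    using assms by (auto simp: graphon_def)
  have Q: "?Q \<in> sets lebesgue"
    by (intro lebesgue_Times) auto
  define F where "F = (\<lambda>p. if p \<in> ?Q then (case p of (x, y) \<Rightarrow> W x y) else 0)"
  have "F \<in> borel_measurable (completion lborel)"
    unfolding F_def using borel_measurable_if[OF Q] Wm by blast
  then obtain g where g: "g \<in> borel_measurable lborel" and ae: "AE p in lborel. F p = g p"
    using completion_ex_borel_measurable_real by blast
  have g' [measurable]: "g \<in> borel_measurable (borel \<Otimes>\<^sub>M borel)"
    using g by (simp add: borel_prod)
  have "AE p in lborel \<Otimes>\<^sub>M lborel. F p = g p"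
    using ae unfolding lborel_prod .
  \<comment> \<open>The swap of coordinates preserves planar measure, so the equation holds at
    \<open>(x, y)\<close> and \<open>(y, x)\<close> together almost everywhere.\<close>
  then have "AE p in distr (lborel \<Otimes>\<^sub>M lborel) (lborel \<Otimes>\<^sub>M lborel) (\<lambda>(x, y). (y, x)). F p = g p"
    by (subst lborel_pair.distr_pair_swap[symmetric])
  from AE_distrD[OF measurable_pair_swap' this]
  have "AE p in lborel. F (case p of (x, y) \<Rightarrow> (y, x)) = g (case p of (x, y) \<Rightarrow> (y, x))"
    unfolding lborel_prod .
  with ae have ae2: "AE (x, y) in lborel. F (x, y) = g (x, y) \<and> F (y, x) = g (y, x)"
    by eventually_elim auto
  define w where "w = (\<lambda>x y. max 0 (min 1 ((g (x, y) + g (y, x)) / 2)))"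
  show thesis
  proof (rule that[of w])
    show "(\<lambda>(x, y). w x y) \<in> borel_measurable (borel \<Otimes>\<^sub>M borel)"
      unfolding w_def by measurable
    show "AE (x, y) in lborel. (x, y) \<in> ?Q \<longrightarrow> W x y = w x y"
      using ae2
    proof (eventually_elim, clarify)
      fix x y assume "F (x, y) = g (x, y)" "F (y, x) = g (y, x)" "x \<in> {0..1::real}" "y \<in> {0..1::real}"
      then have "g (x, y) = W x y" "g (y, x) = W x y" "0 \<le> W x y" "W x y \<le> 1"
        using Ws[of x y] W01[of x y] by (auto simp: F_def)
      then show "W x y = w x y"
        by (simp add: w_def)
    qed
  qed (auto simp: w_def add.commute)
qed

section \<open>The law of the sampled graph\<close>

lemma vertex_pairs_eq: "vertex_pairs k = pairs {1..k}"
  by (simp add: vertex_pairs_def pairs_def)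

lemma graphon_bounds:
  assumes "graphon W" "e \<in> vertex_pairs k" "x \<in> space (Pi\<^sub>M {1..k} (\<lambda>_. unit_lebesgue))"
  shows "0 \<le> W (x (Min e)) (x (Max e))" "W (x (Min e)) (x (Max e)) \<le> 1"
proof -
  have "x (Min e) \<in> {0..1}" "x (Max e) \<in> {0..1}"
    using assms(2,3) unfolding vertex_pairs_eq by (auto elim!: pairsE simp: space_PiM PiE_iff)
  then show "0 \<le> W (x (Min e)) (x (Max e))" "W (x (Min e)) (x (Max e)) \<le> 1"
    using assms(1) by (auto simp: graphon_def)
qed

lemma pmf_edges_given:
  assumes W: "graphon W" and x: "x \<in> space (Pi\<^sub>M {1..k} (\<lambda>_. unit_lebesgue))" and E: "E \<subseteq> vertex_pairs k"
  shows "pmf (edges_given k W x) E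
    = (\<Prod>e\<in>vertex_pairs k. if e \<in> E then W (x (Min e)) (x (Max e)) else 1 - W (x (Min e)) (x (Max e)))"
proof -
  have fin: "finite (vertex_pairs k)"
    by (simp add: vertex_pairs_eq finite_pairs)
  \<comment> \<open>\<open>{e \<in> E}\<close> on the right is the singleton of a truth value, so
    the preimage is a product set and its probability factors over the pairs.\<close>
  have "(\<lambda>b. {e \<in> vertex_pairs k. b e}) -` {E} = Pi (vertex_pairs k) (\<lambda>e. {e \<in> E})"
    using E by (auto simp: Pi_iff)
  then have "pmf (edges_given k W x) E
    = (\<Prod>e\<in>vertex_pairs k. measure_pmf.prob (bernoulli_pmf (W (x (Min e)) (x (Max e)))) {e \<in> E})"
    unfolding edges_given_def pmf_map using fin by (simp add: measure_Pi_pmf_Pi)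
  also have "\<dots> = (\<Prod>e\<in>vertex_pairs k. if e \<in> E then W (x (Min e)) (x (Max e)) else 1 - W (x (Min e)) (x (Max e)))"
    using graphon_bounds[OF W _ x] by (intro prod.cong refl) (auto simp: measure_pmf_single)
  finally show ?thesis .
qed

text \<open>Any two sampled points are distributed as a uniform point of the square, and there are
  finitely many pairs. This allows replacing \<open>W\<close> by its representative in all pairs at
  once.\<close>

lemma AE_PiM_pairs:
  assumes "AE (x, y) in lborel. (x, y) \<in> {0..1} \<times> {0..1} \<longrightarrow> P x y"
  shows "AE x in Pi\<^sub>M {1..k} (\<lambda>_. unit_lebesgue). \<forall>e\<in>vertex_pairs k. P (x (Min e)) (x (Max e))"
proof (rule AE_finite_allI)
  fix e assume "e \<in> vertex_pairs k"
  then obtain i j where e: "Min e = i" "Max e = j" "i \<in> {1..k}" "j \<in> {1..k}" "i \<noteq> j"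
    unfolding vertex_pairs_eq by (auto elim!: pairsE)
  have ae: "AE p in unit_lebesgue \<Otimes>\<^sub>M unit_lebesgue. case p of (x, y) \<Rightarrow> P x y"
    by (rule AE_unit_pair) (use assms in \<open>simp add: case_prod_beta' mem_Times_iff\<close>)
  have "(\<lambda>x. (x i, x j)) \<in> Pi\<^sub>M {1..k} (\<lambda>_. unit_lebesgue) \<rightarrow>\<^sub>M unit_lebesgue \<Otimes>\<^sub>M unit_lebesgue"
    using e by measurable
  from AE_distrD[OF this, unfolded unit.distr_PiM_pair[OF finite_atLeastAtMost e(3-5)], OF ae]
  show "AE x in Pi\<^sub>M {1..k} (\<lambda>_. unit_lebesgue). P (x (Min e)) (x (Max e))"
    by (simp add: e)
qed (simp add: vertex_pairs_eq finite_pairs)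

lemma measurable_edge_weight:
  assumes W: "graphon W" and e: "e \<in> vertex_pairs k"
  shows "(\<lambda>x. W (x (Min e)) (x (Max e))) \<in> borel_measurable (sample_points k)"
proof -
  obtain w :: "real \<Rightarrow> real \<Rightarrow> real" where w: "(\<lambda>(x, y). w x y) \<in> borel_measurable (borel \<Otimes>\<^sub>M borel)"
    "AE (x, y) in lborel. (x, y) \<in> {0..1} \<times> {0..1} \<longrightarrow> W x y = w x y"
    using W by (rule graphon_borel_representative)
  note [measurable] = unit_pair_measurable_of_borel[OF w(1)]
  obtain i j where ij: "Min e = i" "Max e = j" "i \<in> {1..k}" "j \<in> {1..k}"
    using e unfolding vertex_pairs_eq by (auto elim!: pairsE)
  show ?thesis
    unfolding sample_points_def
  proof (rule measurable_completion_AE)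
    show "(\<lambda>x. w (x (Min e)) (x (Max e))) \<in> borel_measurable (Pi\<^sub>M {1..k} (\<lambda>_. unit_lebesgue))"
      unfolding ij(1,2) using ij(3,4) by measurable
    show "AE x in Pi\<^sub>M {1..k} (\<lambda>_. unit_lebesgue). W (x (Min e)) (x (Max e)) = w (x (Min e)) (x (Max e))"
      using AE_PiM_pairs[OF w(2), of k] by eventually_elim (use e in auto)
  qed
qed

lemma set_pmf_edges_given: "set_pmf (edges_given k W x) \<subseteq> Pow (vertex_pairs k)"
  by (auto simp: edges_given_def)

text \<open>Required for the bind in \<open>sample_graph\<close>. The support lies in the finite set
  \<open>Pow (vertex_pairs k)\<close>, so the measure of any \<open>A\<close> is a finite sum of
  products of measurable functions.\<close>

lemma measurable_edges_given:
  assumes W: "graphon W"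
  shows "(\<lambda>x. measure_pmf (edges_given k W x)) \<in> sample_points k \<rightarrow>\<^sub>M subprob_algebra (count_space UNIV)"
proof (rule measurable_subprob_algebra)
  fix A :: "nat set set set"
  let ?V = "vertex_pairs k"
  have fin: "finite (A \<inter> Pow ?V)"
    by (simp add: vertex_pairs_eq finite_pairs)
  have "emeasure (measure_pmf (edges_given k W x)) A = emeasure (measure_pmf (edges_given k W x)) (A \<inter> Pow ?V)" for x
    using set_pmf_edges_given[of k W x] by (intro emeasure_eq_AE AE_pmfI) auto
  then have eq: "emeasure (measure_pmf (edges_given k W x)) A
    = ennreal (\<Sum>E\<in>A \<inter> Pow ?V. (\<Prod>e\<in>?V. if e \<in> E then W (x (Min e)) (x (Max e)) else 1 - W (x (Min e)) (x (Max e))))"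
    if "x \<in> space (sample_points k)" for x
    using that W fin by (simp add: emeasure_measure_pmf_finite pmf_edges_given sample_points_def)
  note [measurable] = measurable_edge_weight[OF W]
  show "(\<lambda>x. emeasure (measure_pmf (edges_given k W x)) A) \<in> borel_measurable (sample_points k)"
    by (subst measurable_cong[OF eq], assumption) measurable
qed (auto intro: measure_pmf.subprob_space_axioms)

lemma prob_space_sample_points: "prob_space (sample_points k)"
proof -
  interpret P: product_prob_space "\<lambda>_. unit_lebesgue" "{1..k}"
    by unfold_locales
  show ?thesis
    unfolding sample_points_def
    by (rule prob_spaceI) (use P.P.emeasure_space_1 in simp)
qed

lemma emeasure_no_edges:
  assumes W: "graphon W"
  shows "emeasure (sample_graph k W) {G. edge_count G = 0}
    = (\<integral>\<^sup>+x. ennreal (\<Prod>e\<in>vertex_pairs k. 1 - W (x (Min e)) (x (Max e))) \<partial>Pi\<^sub>M {1..k} (\<lambda>_. unit_lebesgue))"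
proof -
  interpret prob_space "sample_points k"
    by (rule prob_space_sample_points)
  have "emeasure (sample_graph k W) {G. edge_count G = 0}
    = (\<integral>\<^sup>+x. emeasure (measure_pmf (edges_given k W x)) {G. edge_count G = 0} \<partial>sample_points k)"
    unfolding sample_graph_def
    by (rule emeasure_bind[OF not_empty measurable_edges_given[OF W]]) simp
  also have "\<dots> = (\<integral>\<^sup>+x. ennreal (\<Prod>e\<in>vertex_pairs k. 1 - W (x (Min e)) (x (Max e))) \<partial>sample_points k)"
  proof (rule nn_integral_cong)
    fix x assume x: "x \<in> space (sample_points k)"
    \<comment> \<open>\<open>edge_count\<close> is 0 also on infinite sets; in the support
      \<open>G\<close> is finite, so it must be empty.\<close>
    have "emeasure (measure_pmf (edges_given k W x)) {G. edge_count G = 0}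
      = emeasure (measure_pmf (edges_given k W x)) {{}}"
    proof (intro emeasure_eq_AE AE_pmfI)
      fix G assume "G \<in> set_pmf (edges_given k W x)"
      then have "finite G"
        using set_pmf_edges_given by (metis PowD finite_subset finite_pairs finite_atLeastAtMost subsetD vertex_pairs_eq)
      then show "G \<in> {G. edge_count G = 0} \<longleftrightarrow> G \<in> {{}}"
        by (simp add: edge_count_def)
    qed auto
    also have "\<dots> = ennreal (\<Prod>e\<in>vertex_pairs k. 1 - W (x (Min e)) (x (Max e)))"
      using x W by (simp add: emeasure_pmf_single pmf_edges_given sample_points_def)
    finally show "emeasure (measure_pmf (edges_given k W x)) {G. edge_count G = 0}
      = ennreal (\<Prod>e\<in>vertex_pairs k. 1 - W (x (Min e)) (x (Max e)))" .
  qed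
  finally show ?thesis
    by (simp add: sample_points_def nn_integral_completion)
qed

lemma independent_in_iff:
  assumes w: "AE (x, y) in lborel. (x, y) \<in> {0..1} \<times> {0..1} \<longrightarrow> W x y = w x y"
  shows "independent_in W S \<longleftrightarrow> S \<in> sets lebesgue \<and> S \<subseteq> {0..1} \<and>
    (AE (x, y) in lborel. x \<in> S \<longrightarrow> y \<in> S \<longrightarrow> w x y = 0)"
proof -
  have "(AE (x, y) in lebesgue_on (S \<times> S). W x y = 0) \<longleftrightarrow> (AE (x, y) in lborel. x \<in> S \<longrightarrow> y \<in> S \<longrightarrow> w x y = 0)"
    if S: "S \<in> sets lebesgue" "S \<subseteq> {0..1}"
  proof -
    have "(AE (x, y) in lebesgue_on (S \<times> S). W x y = 0) \<longleftrightarrow> (AE (x, y) in lborel. x \<in> S \<longrightarrow> y \<in> S \<longrightarrow> W x y = 0)"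
      using lebesgue_Times[OF S] by (simp add: AE_restrict_space_iff AE_completion_iff case_prod_beta' mem_Times_iff imp_conjL)
    also have "\<dots> \<longleftrightarrow> (AE (x, y) in lborel. x \<in> S \<longrightarrow> y \<in> S \<longrightarrow> w x y = 0)"
    proof
      assume "AE (x, y) in lborel. x \<in> S \<longrightarrow> y \<in> S \<longrightarrow> W x y = 0"
      then show "AE (x, y) in lborel. x \<in> S \<longrightarrow> y \<in> S \<longrightarrow> w x y = 0"
        using w by eventually_elim (use S(2) in force)
    next
      assume "AE (x, y) in lborel. x \<in> S \<longrightarrow> y \<in> S \<longrightarrow> w x y = 0"
      then show "AE (x, y) in lborel. x \<in> S \<longrightarrow> y \<in> S \<longrightarrow> W x y = 0"
        using w by eventually_elim (use S(2) in force)
    qed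
    finally show ?thesis .
  qed
  then show ?thesis
    by (auto simp: independent_in_def)
qed

section \<open>The two bounds for the probability of having no edges\<close>

locale graphon_representative =
  fixes W w :: "real \<Rightarrow> real \<Rightarrow> real"
  assumes graphon: "graphon W"
    and w_measurable: "(\<lambda>(x, y). w x y) \<in> borel_measurable (borel \<Otimes>\<^sub>M borel)"
    and w_nonneg: "0 \<le> w x y" and w_le_1: "w x y \<le> 1" and w_sym: "w x y = w y x"
    and w_eq: "AE (x, y) in lborel. (x, y) \<in> {0..1} \<times> {0..1} \<longrightarrow> W x y = w x y"
begin

sublocale unit_kernel w
proof unfold_locales
  show "(\<lambda>(x, y). w x y) \<in> borel_measurable (unit_lebesgue \<Otimes>\<^sub>M unit_lebesgue)"
    by (rule unit_pair_measurable_of_borel[OF w_measurable])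
qed (fact w_nonneg w_le_1 w_sym)+

text \<open>The container bound is applied to the non-edge probability; its \<open>energy\<close>
  then has the kernel \<open>1 - (1 - w)\<close>, that is, \<open>w\<close>.\<close>

sublocale avoid: sym_kernel unit_lebesgue "\<lambda>x y. 1 - w x y"
proof unfold_locales
  show "(\<lambda>(x, y). 1 - w x y) \<in> borel_measurable (unit_lebesgue \<Otimes>\<^sub>M unit_lebesgue)"
    by measurable
qed (auto simp: w_nonneg w_le_1 w_sym)

lemma emeasure_no_edges_eq_partition:
  "emeasure (sample_graph k W) {G. edge_count G = 0} = avoid.partition {1..k} (\<lambda>_. 1)"
  unfolding emeasure_no_edges[OF graphon] avoid.partition_def
proof (rule nn_integral_cong_AE)
  show "AE x in Pi\<^sub>M {1..k} (\<lambda>_. unit_lebesgue).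
    ennreal (\<Prod>e\<in>vertex_pairs k. 1 - W (x (Min e)) (x (Max e))) = ennreal (avoid.weight {1..k} (\<lambda>_. 1) x)"
    using AE_PiM_pairs[OF w_eq, of k] by eventually_elim (simp add: avoid.weight_def vertex_pairs_eq)
qed

definition no_edge_prob :: "nat \<Rightarrow> real" where
  "no_edge_prob k = \<P>(G in sample_graph k W. edge_count G = 0)"

lemma ennreal_no_edge_prob: "ennreal (no_edge_prob k) = avoid.partition {1..k} (\<lambda>_. 1)"
proof -
  interpret S: prob_space "sample_points k"
    by (rule prob_space_sample_points)
  have "sets (sample_graph k W) = sets (count_space UNIV)"
    unfolding sample_graph_def by (rule sets_bind) (simp_all add: S.not_empty)
  from sets_eq_imp_space_eq[OF this] have space: "space (sample_graph k W) = UNIV"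
    by simp
  have "avoid.partition {1..k} (\<lambda>_. 1) \<le> (\<integral>\<^sup>+x. ennreal 1 \<partial>unit_lebesgue) ^ card {1..k}"
    by (rule avoid.partition_le_power) auto
  also have "\<dots> = 1"
    using unit.emeasure_space_1 by simp
  finally have "avoid.partition {1..k} (\<lambda>_. 1) \<noteq> \<top>"
    by (auto simp: top_unique)
  then show ?thesis
    unfolding no_edge_prob_def emeasure_no_edges_eq_partition[symmetric]
    by (subst emeasure_eq_ennreal_measure) (simp_all add: space)
qed

text \<open>All points fall into \<open>S\<close> with probability
  \<open>measure lebesgue S ^ k\<close>, and then almost surely every pair has edge probability
  0.\<close>

lemma independent_power_le:
  assumes "independent_in W S"
  shows "measure lebesgue S ^ k \<le> no_edge_prob k"
proof -
  have S: "S \<in> sets lebesgue" "S \<subseteq> {0..1}" and ae: "AE (x, y) in lborel. x \<in> S \<longrightarrow> y \<in> S \<longrightarrow> w x y = 0"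
    using assms unfolding independent_in_iff[OF w_eq] by auto
  have S_sets [measurable]: "S \<in> sets unit_lebesgue"
    using S by (simp add: sets_restrict_space_iff)
  have S_eq: "emeasure unit_lebesgue S = emeasure lebesgue S"
    using S by (simp add: emeasure_restrict_space)
  then have S_measure: "emeasure unit_lebesgue S = ennreal (measure lebesgue S)"
    by (metis Sigma_Algebra.measure_def unit.emeasure_eq_measure)
  have "ennreal (measure lebesgue S ^ k) = (\<integral>\<^sup>+x. indicator S x \<partial>unit_lebesgue) ^ card {1..k}"
    by (simp add: S_measure ennreal_power)
  also have "\<dots> = (\<integral>\<^sup>+x. (\<Prod>i\<in>{1..k}. indicator S (x i)) \<partial>Pi\<^sub>M {1..k} (\<lambda>_. unit_lebesgue))"
    by (rule nn_integral_prod_const[symmetric]) auto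
  also have "\<dots> \<le> (\<integral>\<^sup>+x. ennreal (avoid.weight {1..k} (\<lambda>_. 1) x) \<partial>Pi\<^sub>M {1..k} (\<lambda>_. unit_lebesgue))"
  proof (rule nn_integral_mono_AE)
    have "AE (x, y) in lborel. (x, y) \<in> {0..1} \<times> {0..1} \<longrightarrow> (x \<in> S \<longrightarrow> y \<in> S \<longrightarrow> w x y = 0)"
      using ae by eventually_elim auto
    from AE_PiM_pairs[OF this, of k]
    show "AE x in Pi\<^sub>M {1..k} (\<lambda>_. unit_lebesgue). (\<Prod>i\<in>{1..k}. indicator S (x i)) \<le> ennreal (avoid.weight {1..k} (\<lambda>_. 1) x)"
    proof eventually_elim
      fix x assume x: "\<forall>e\<in>vertex_pairs k. x (Min e) \<in> S \<longrightarrow> x (Max e) \<in> S \<longrightarrow> w (x (Min e)) (x (Max e)) = 0"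
      show "(\<Prod>i\<in>{1..k}. indicator S (x i)) \<le> ennreal (avoid.weight {1..k} (\<lambda>_. 1) x)"
      proof (cases "\<forall>i\<in>{1..k}. x i \<in> S")
        case True
        have "1 - w (x (Min e)) (x (Max e)) = 1" if "e \<in> pairs {1..k}" for e
          using that
        proof (rule pairsE)
          fix i j assume "i \<in> {1..k}" "j \<in> {1..k}" "Min e = i" "Max e = j"
          then show ?thesis
            using x that True unfolding vertex_pairs_eq by auto
        qed
        then have "avoid.weight {1..k} (\<lambda>_. 1) x = 1"
          by (simp add: avoid.weight_def)
        then show ?thesis
          using True by simp
      next
        case False
        then have "(\<Prod>i\<in>{1..k}. indicator S (x i)) = (0::ennreal)"
          by (intro prod_zero) (auto simp: indicator_def)
        then show ?thesis
          by (simp only: zero_le)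
      qed
    qed
  qed
  also have "\<dots> = ennreal (no_edge_prob k)"
    by (simp add: ennreal_no_edge_prob avoid.partition_def)
  finally show ?thesis
    by (subst (asm) ennreal_le_iff) (auto simp: no_edge_prob_def)
qed

lemma independence_ratio_upper:
  assumes "independent_in W S"
  shows "measure lebesgue S \<le> independence_ratio W"
  unfolding independence_ratio_def
proof (rule cSUP_upper)
  show "bdd_above (measure lebesgue ` {S. independent_in W S})"
  proof (rule bdd_aboveI2)
    fix T assume "T \<in> {S. independent_in W S}"
    then have "measure lebesgue T \<le> measure lebesgue {0..1::real}"
      by (intro measure_mono_fmeasurable) (auto simp: independent_in_def fmeasurable_def)
    then show "measure lebesgue T \<le> 1"
      by simp
  qed
qed (use assms in simp)

lemma independent_in_empty: "independent_in W {}"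
  by (auto simp: independent_in_def intro!: AE_I2)

lemma independence_ratio_nonneg: "0 \<le> independence_ratio W"
  using independence_ratio_upper[OF independent_in_empty] by simp

text \<open>If every \<open>d = 1 / Suc n\<close> failed, the counterexamples would have vanishing
  energy and integrals above \<open>b\<close>. They would yield an independent set of measure at
  least \<open>b\<close>, which exceeds the independence ratio.\<close>

lemma low_energy_bound:
  assumes b: "independence_ratio W < b"
  shows "\<exists>d>0. \<forall>g\<in>borel_measurable unit_lebesgue. (\<forall>x. 0 \<le> g x) \<longrightarrow> (\<forall>x. g x \<le> 1) \<longrightarrow>
    avoid.energy g \<le> ennreal d \<longrightarrow> (\<integral>\<^sup>+x. g x \<partial>unit_lebesgue) \<le> ennreal b"
proof (rule ccontr)
  assume contra: "\<not> ?thesis"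
  have "\<exists>g. g \<in> borel_measurable unit_lebesgue \<and> (\<forall>x. 0 \<le> g x) \<and> (\<forall>x. g x \<le> 1) \<and>
    avoid.energy g \<le> ennreal (1 / real (Suc n)) \<and> ennreal b \<le> (\<integral>\<^sup>+x. g x \<partial>unit_lebesgue)" for n
  proof -
    have "0 < 1 / real (Suc n)"
      by simp
    with contra obtain g where "g \<in> borel_measurable unit_lebesgue" "\<forall>x. 0 \<le> g x" "\<forall>x. g x \<le> 1"
      "avoid.energy g \<le> ennreal (1 / real (Suc n))" "\<not> (\<integral>\<^sup>+x. g x \<partial>unit_lebesgue) \<le> ennreal b"
      by meson
    then show ?thesis
      by (intro exI[of _ g] conjI) (simp_all add: not_le less_imp_le)
  qed
  then obtain g where g: "\<And>n. g n \<in> borel_measurable unit_lebesgue" "\<And>n x. 0 \<le> g n x" "\<And>n x. g n x \<le> 1"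
    and energy: "\<And>n. avoid.energy (g n) \<le> ennreal (1 / real (Suc n))"
    and g_b: "\<And>n. ennreal b \<le> (\<integral>\<^sup>+x. g n x \<partial>unit_lebesgue)"
    by metis
  have "(\<lambda>n. ennreal (1 / real (Suc n))) \<longlonglongrightarrow> ennreal 0"
    by (rule tendsto_ennrealI[OF LIMSEQ_Suc[OF lim_1_over_n]])
  then have "(\<lambda>n. ennreal (1 / real (Suc n))) \<longlonglongrightarrow> 0"
    unfolding ennreal_0 .
  then have "(\<lambda>n. avoid.energy (g n)) \<longlonglongrightarrow> 0"
    by (rule tendsto_sandwich[OF always_eventually always_eventually tendsto_const, rotated 2])
      (simp_all only: energy zero_le simp_thms)
  then have "(\<lambda>n. \<integral>\<^sup>+x. \<integral>\<^sup>+y. ennreal (g n x * g n y * w x y) \<partial>unit_lebesgue \<partial>unit_lebesgue) \<longlonglongrightarrow> 0"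
    by (simp add: avoid.energy_def)
  from independent_set_of_vanishing_energy[OF g this g_b]
  obtain S where S: "S \<in> sets unit_lebesgue" "ennreal b \<le> emeasure unit_lebesgue S"
    and ae: "AE x in unit_lebesgue. AE y in unit_lebesgue. x \<in> S \<longrightarrow> y \<in> S \<longrightarrow> w x y = 0"
    by blast
  have S': "S \<in> sets lebesgue" "S \<subseteq> {0..1}"
    using S(1) by (auto simp: sets_restrict_space_iff)
  then have S_eq: "emeasure unit_lebesgue S = emeasure lebesgue S"
    by (simp add: emeasure_restrict_space)
  \<comment> \<open>Joining the iterated almost everywhere statement into a planar one requires a
    measurable predicate, hence a Borel set inside \<open>S\<close> of the same measure.\<close>
  obtain B C where B: "B \<in> sets borel" "B \<subseteq> S" "emeasure lborel B = emeasure lebesgue S"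
    using S'(1) by (rule borel_sandwich)
  have B_sets [measurable]: "B \<in> sets borel"
    by fact
  note [measurable] = w_measurable
  have "AE x in lborel. AE y in lborel. x \<in> B \<longrightarrow> y \<in> B \<longrightarrow> w x y = 0"
    using ae unfolding AE_unit_lebesgue_iff
  proof (elim eventually_mono)
    fix x assume "x \<in> {0..1} \<longrightarrow> (AE y in lborel. y \<in> {0..1} \<longrightarrow> x \<in> S \<longrightarrow> y \<in> S \<longrightarrow> w x y = 0)"
    then show "AE y in lborel. x \<in> B \<longrightarrow> y \<in> B \<longrightarrow> w x y = 0"
      using B(2) S'(2) by (cases "x \<in> B") (auto elim!: eventually_mono)
  qed
  then have "AE p in lborel \<Otimes>\<^sub>M lborel. fst p \<in> B \<longrightarrow> snd p \<in> B \<longrightarrow> w (fst p) (snd p) = 0"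
    by (subst lborel_pair.AE_pair_iff[symmetric]) measurable
  then have "AE (x, y) in lborel. x \<in> B \<longrightarrow> y \<in> B \<longrightarrow> w x y = 0"
    unfolding lborel_prod case_prod_beta' .
  then have "independent_in W B"
    unfolding independent_in_iff[OF w_eq] using B S'(2) by auto
  then have "measure lebesgue B \<le> independence_ratio W"
    by (rule independence_ratio_upper)
  moreover have "emeasure lebesgue B = emeasure unit_lebesgue S"
    using B S_eq by simp
  then have "measure lebesgue B = measure unit_lebesgue S"
    by (simp add: Sigma_Algebra.measure_def)
  moreover have "b \<le> measure unit_lebesgue S"
    using S(2) by (simp add: unit.emeasure_eq_measure)
  ultimately show False
    using b by linarith
qed

text \<open>The lower bound holds for each \<open>k > 0\<close>, by taking roots in
  \<open>independent_power_le\<close>. For the upper bound, \<open>no_edge_prob k\<close> is at most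
  a polynomial in \<open>k\<close> times \<open>b ^ k\<close> with some \<open>b < a\<close>, and
  the \<open>k\<close>-th root of the polynomial tends to 1.\<close>

lemma no_edge_prob_tendsto:
  "(\<lambda>k. no_edge_prob k powr (1 / real k)) \<longlonglongrightarrow> independence_ratio W"
proof (rule order_tendstoI)
  fix a assume a: "a < independence_ratio W"
  have "independence_ratio W \<le> no_edge_prob k powr (1 / real k)" if k: "0 < k" for k
    unfolding independence_ratio_def
  proof (rule cSUP_least)
    show "{S. independent_in W S} \<noteq> {}"
      using independent_in_empty by blast
    fix S assume "S \<in> {S. independent_in W S}"
    then have "(measure lebesgue S ^ k) powr (1 / real k) \<le> no_edge_prob k powr (1 / real k)"
      by (intro powr_mono2 independent_power_le) auto
    moreover have "(measure lebesgue S ^ k) powr (1 / real k) = measure lebesgue S"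
      using k by (cases "measure lebesgue S = 0") (auto simp: powr_realpow[symmetric] powr_powr zero_less_measure_iff)
    ultimately show "measure lebesgue S \<le> no_edge_prob k powr (1 / real k)"
      by simp
  qed
  then show "\<forall>\<^sub>F k in sequentially. a < no_edge_prob k powr (1 / real k)"
    by (intro eventually_mono[OF eventually_gt_at_top[of 0]] less_le_trans[OF a])
next
  fix a assume a: "independence_ratio W < a"
  \<comment> \<open>Above the ratio, so that a threshold \<open>d\<close> for containers exists, and
    below \<open>a\<close>, which leaves room for the polynomial factor.\<close>
  define b where "b = (independence_ratio W + a) / 2"
  have b: "independence_ratio W < b" "b < a" "0 < b"
    using a independence_ratio_nonneg by (auto simp: b_def)
  obtain d where d: "0 < d" and container: "\<And>g. g \<in> borel_measurable unit_lebesgue \<Longrightarrow> (\<And>x. 0 \<le> g x) \<Longrightarrow>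
      (\<And>x. g x \<le> 1) \<Longrightarrow> avoid.energy g \<le> ennreal d \<Longrightarrow> (\<integral>\<^sup>+x. g x \<partial>unit_lebesgue) \<le> ennreal b"
    using low_energy_bound[OF b(1)] by metis
  define c where "c = max 1 (1 / b)"
  have c: "0 < c"
    by (simp add: c_def)
  \<comment> \<open>The initial activity 1 has integral 1, so at most \<open>m\<close> rounds are
    possible; \<open>m\<close> does not depend on \<open>k\<close>.\<close>
  obtain m where m: "1 < real m * d"
    using reals_Archimedean3[OF d] by blast
  then have m0: "0 < real m"
    by (cases m) auto
  have bound: "no_edge_prob k \<le> ((real k + 1) * c) ^ m * b ^ k" for k
  proof -
    have "avoid.partition {1..k} (\<lambda>_. 1) \<le> ennreal (((real (card {1..k}) + 1) * max 1 (1 / b)) ^ m * b ^ card {1..k})"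
      using m unit.emeasure_space_1 by (intro avoid.partition_bound[OF d b(3) container]) auto
    then have "ennreal (no_edge_prob k) \<le> ennreal (((real k + 1) * c) ^ m * b ^ k)"
      by (simp add: ennreal_no_edge_prob c_def)
    then show ?thesis
      using b(3) c by (subst (asm) ennreal_le_iff) auto
  qed
  have "(\<lambda>k. ((real k + 1) * c) powr (real m / real k) * b) \<longlonglongrightarrow> 1 * b"
  proof (intro tendsto_intros)
    show "(\<lambda>k. ((real k + 1) * c) powr (real m / real k)) \<longlonglongrightarrow> 1"
      using c m0 by real_asymp
  qed
  then have "\<forall>\<^sub>F k in sequentially. ((real k + 1) * c) powr (real m / real k) * b < a"
    using b by (intro order_tendstoD) auto
  then show "\<forall>\<^sub>F k in sequentially. no_edge_prob k powr (1 / real k) < a"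
    using eventually_gt_at_top[of 0]
  proof eventually_elim
    case (elim k)
    have "no_edge_prob k powr (1 / real k) \<le> (((real k + 1) * c) ^ m * b ^ k) powr (1 / real k)"
      by (intro powr_mono2 bound) (auto simp: no_edge_prob_def)
    also have "\<dots> = ((real k + 1) * c) powr (real m / real k) * b"
      using b c elim by (simp add: powr_mult powr_realpow[symmetric] powr_powr)
    also have "\<dots> < a"
      by fact
    finally show ?case .
  qed
qed

end

theorem theorem6:
  fixes W :: "real \<Rightarrow> real \<Rightarrow> real"
  assumes "graphon W"
  shows "(\<lambda>k. \<P>(G in sample_graph k W. edge_count G = 0) powr (1 / real k))
           \<longlonglongrightarrow> independence_ratio W"
proof (rule graphon_borel_representative[OF assms])
  fix w :: "real \<Rightarrow> real \<Rightarrow> real"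
  assume w: "(\<lambda>(x, y). w x y) \<in> borel_measurable (borel \<Otimes>\<^sub>M borel)"
    "\<And>x y. 0 \<le> w x y" "\<And>x y. w x y \<le> 1" "\<And>x y. w x y = w y x"
    "AE (x, y) in lborel. (x, y) \<in> {0..1} \<times> {0..1} \<longrightarrow> W x y = w x y"
  interpret graphon_representative W w
    by unfold_locales (fact assms w)+
  show ?thesis
    using no_edge_prob_tendsto by (simp add: no_edge_prob_def)
qed

end
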